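(* Let $n\ge0$ and let $f\in\mathbb{C}[x_1,\ldots,x_{n+1}]$ be weighted-Lê-Yomdin-at-infinity with respect to $(\mathbf{w};N;k)$. Assume that at least one of the following holds: (a) $k=1$; (b) there is a weighted homogeneous polynomial of type $(\mathbf{w};N)$ having only an isolated singularity at the origin; (c) every transversal singularity $g_j=0$ of $f_N$ satisfies $\mu_0(g_j)=\tau_0(g_j)$. If moreover $N-k\ge\max_i w_i$, then $f$ is tame. In particular, if $\mathbf{w}=(1,1,\ldots,1)$, then every $f$ which is weighted-Lê-Yomdin-at-infinity with respect to $(\mathbf{w};N;k)$ is tame, for any $0<k<N$.
   Context: **Weights and WLY polynomials.** $\mathbf{w}=(w_1,\ldots,w_{n+1})$ is a vector of positive integers with $\gcd(w_1,\ldots,w_{n+1})=1$. A non-constant polynomial $f$ is written $f=f_N+f_{N-1}+\cdots+f_0$, where $f_i$ is the part of weighted degree $i$ (with $\deg x_i=w_i$) and $f_N\ne0$; $N-k$ is the largest integer smaller than $N$ with $f_{N-k}\neq0$, and it is assumed that $0<k<N$. Write $\partial f=(\partial f/\partial x_1,\ldots,\partial f/\partial x_{n+1})$. The polynomial $f$ is *weighted-Lê-Yomdin-at-infinity* with respect to $(\mathbf{w};N;k)$ if $\{x\in\mathbb{C}^{n+1}\mid \partial f_N(x)=0,\ f_{N-k}(x)=0\}\subset\{0\}$. In this case $\{\partial f_N=0\}$ has dimension at most $1$. **Type.** A polynomial is of type $(\mathbf{w};N)$ if it is weighted homogeneous of degree $N$ for the weights $\mathbf{w}$; it has only an isolated singularity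 at the origin if its critical locus is contained in $\{0\}$. **Transversal singularities.** $\mathbb{C}^*$ acts on $\mathbb{C}^{n+1}$ by $u\cdot x=(u^{-w_1}x_1,\ldots,u^{-w_{n+1}}x_{n+1})$. If $\{\partial f_N=0\}$ is one-dimensional, then $\{\partial f_N=0\}=\{0\}\cup\bigcup_{j=1}^p\mathbb{C}^*\cdot a^j$ with distinct orbits (otherwise $p=0$). For $a=a^j$, after permuting the coordinates assume $a_{n+1}\ne0$; the transversal singularity of $f_N$ along $\mathbb{C}^*\cdot a$ is the isolated hypersurface singularity defined by the germ $g_j(y)=f_N(y_1+a_1,\ldots,y_n+a_n,a_{n+1})$ at $0\in\mathbb{C}^n$. Its Milnor number is $\mu_0(g)=\dim_{\mathbb{C}}\mathbb{C}[[y_1,\ldots,y_n]]/(\partial g/\partial y_1,\ldots,\partial g/\partial y_n)$ and its Tjurina number is $\tau_0(g)=\dim_{\mathbb{C}}\mathbb{C}[[y_1,\ldots,y_n]]/(g,\partial g/\partial y_1,\ldots,\partial g/\partial y_n)$. **Tame.** A polynomial $f:\mathbb{C}^{n+1}\to\mathbb{C}$ is tame if there exist a real number $\varepsilon>0$ and a compact set $K\subset\mathbb{C}^{n+1}$ such that $\|\partial f(x)\|>\varepsilon$ for all $x\in\mathbb{C}^{n+1}\setminus K$. *)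

theory Defs
  imports
    "HOL-Analysis.Analysis"
    "HOL-Algebra.Embedded_Algebras"
    "HOL-Algebra.QuotRing"
    "HOL-Library.Poly_Mapping"
    "HOL-Library.Extended_Nat"
begin

text \<open>
  The coordinates of \<open>\<complex>\<^sup>n\<^sup>+\<^sup>1\<close> are indexed by a finite type \<open>'n\<close> with \<open>n + 1\<close> elements. Types are
  nonempty, so every \<open>n \<ge> 0\<close> occurs. A polynomial is a finitely supported map from exponents
  to coefficients; \<^typ>\<open>('n \<Rightarrow>\<^sub>0 nat) \<Rightarrow>\<^sub>0 complex\<close> carries the ring structure of \<open>\<complex>[x\<^sub>1, \<dots>, x\<^sub>n\<^sub>+\<^sub>1]\<close>.
\<close>

type_synonym 'n cpoly = "('n \<Rightarrow>\<^sub>0 nat) \<Rightarrow>\<^sub>0 complex"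

definition pconst :: "complex \<Rightarrow> 'n cpoly" where
  "pconst c = Poly_Mapping.single 0 c"

definition pvar :: "'n \<Rightarrow> 'n cpoly" where
  "pvar i = Poly_Mapping.single (Poly_Mapping.single i 1) 1"

definition peval :: "'n::finite cpoly \<Rightarrow> complex ^ 'n \<Rightarrow> complex" where
  "peval f x = (\<Sum>m\<in>Poly_Mapping.keys f. Poly_Mapping.lookup f m * (\<Prod>i\<in>UNIV. x $ i ^ Poly_Mapping.lookup m i))"

definition psubst :: "'n::finite cpoly \<Rightarrow> ('n \<Rightarrow> 'n cpoly) \<Rightarrow> 'n cpoly" where
  "psubst f s = (\<Sum>m\<in>Poly_Mapping.keys f. pconst (Poly_Mapping.lookup f m) * (\<Prod>i\<in>UNIV. s i ^ Poly_Mapping.lookup m i))"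

text \<open>Where \<open>m\<close> does not involve \<open>x\<^sub>i\<close>, the exponent below is truncated but the coefficient is 0.\<close>

definition pderiv_wrt :: "'n \<Rightarrow> 'n cpoly \<Rightarrow> 'n cpoly" where
  "pderiv_wrt i f = (\<Sum>m\<in>Poly_Mapping.keys f.
     Poly_Mapping.single (m - Poly_Mapping.single i 1) (of_nat (Poly_Mapping.lookup m i) * Poly_Mapping.lookup f m))"

definition grad :: "'n::finite cpoly \<Rightarrow> complex ^ 'n \<Rightarrow> complex ^ 'n" where
  "grad f x = (\<chi> i. peval (pderiv_wrt i f) x)"

definition crit_locus :: "'n::finite cpoly \<Rightarrow> (complex ^ 'n) set" where
  "crit_locus f = {x. grad f x = 0}"

definition tame :: "'n::finite cpoly \<Rightarrow> bool" where
  "tame f \<longleftrightarrow> (\<exists>\<epsilon>>0. \<exists>K. compact K \<and> (\<forall>x. x \<notin> K \<longrightarrow> norm (grad f x) > \<epsilon>))"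

section \<open>Weights\<close>

definition weight_vector :: "('n::finite \<Rightarrow> nat) \<Rightarrow> bool" where
  "weight_vector w \<longleftrightarrow> (\<forall>i. 0 < w i) \<and> Gcd (range w) = 1"

definition wdeg :: "('n::finite \<Rightarrow> nat) \<Rightarrow> ('n \<Rightarrow>\<^sub>0 nat) \<Rightarrow> nat" where
  "wdeg w m = (\<Sum>i\<in>UNIV. w i * Poly_Mapping.lookup m i)"

definition wpart :: "('n::finite \<Rightarrow> nat) \<Rightarrow> nat \<Rightarrow> 'n cpoly \<Rightarrow> 'n cpoly" where
  "wpart w d f = (\<Sum>m\<in>{m \<in> Poly_Mapping.keys f. wdeg w m = d}. Poly_Mapping.single m (Poly_Mapping.lookup f m))"

definition of_type :: "('n::finite \<Rightarrow> nat) \<Rightarrow> nat \<Rightarrow> 'n cpoly \<Rightarrow> bool" where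
  "of_type w d f \<longleftrightarrow> (\<forall>m\<in>Poly_Mapping.keys f. wdeg w m = d)"

definition isolated_sing_at_origin :: "'n::finite cpoly \<Rightarrow> bool" where
  "isolated_sing_at_origin f \<longleftrightarrow> crit_locus f \<subseteq> {0}"

text \<open>The conditions \<open>f\<^sub>N \<noteq> 0\<close> and \<open>0 < N\<close> make \<open>f\<close> non-constant.\<close>

definition wly_at_infinity :: "('n::finite \<Rightarrow> nat) \<Rightarrow> nat \<Rightarrow> nat \<Rightarrow> 'n cpoly \<Rightarrow> bool" where
  "wly_at_infinity w N k f \<longleftrightarrow>
     weight_vector w \<and> 0 < k \<and> k < N \<and>
     wpart w N f \<noteq> 0 \<and> (\<forall>d>N. wpart w d f = 0) \<and>
     wpart w (N - k) f \<noteq> 0 \<and> (\<forall>d. N - k < d \<and> d < N \<longrightarrow> wpart w d f = 0) \<and>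
     {x. grad (wpart w N f) x = 0 \<and> peval (wpart w (N - k) f) x = 0} \<subseteq> {0}"

section \<open>Milnor and Tjurina numbers\<close>

text \<open>
  The ring \<open>\<complex>[[y\<^sub>i | i \<in> V]]\<close>: arbitrary coefficient families whose exponents only involve
  variables from \<open>V\<close>, with the Cauchy product.
\<close>

definition power_series_ring :: "'n set \<Rightarrow> (('n \<Rightarrow>\<^sub>0 nat) \<Rightarrow> complex) ring" where
  "power_series_ring V =
     \<lparr>carrier = {F. \<forall>m. F m \<noteq> 0 \<longrightarrow> Poly_Mapping.keys m \<subseteq> V},
      mult = (\<lambda>F G m. \<Sum>(a, b)\<in>{(a, b). a + b = m}. F a * G b),
      one = (\<lambda>m. if m = 0 then 1 else 0),
      zero = (\<lambda>m. 0),
      add = (\<lambda>F G m. F m + G m)\<rparr>"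

definition series_const :: "complex \<Rightarrow> ('n \<Rightarrow>\<^sub>0 nat) \<Rightarrow> complex" where
  "series_const c = (\<lambda>m. if m = 0 then c else 0)"

text \<open>
  \<open>dim\<^sub>\<complex> \<complex>[[y\<^sub>i | i \<in> V]] / I\<close>, with value \<open>\<infinity>\<close> if there is no finite basis. The scalars are the
  images of the constant series in the quotient.
\<close>

definition quotient_dim :: "'n set \<Rightarrow> (('n \<Rightarrow>\<^sub>0 nat) \<Rightarrow> complex) set \<Rightarrow> enat" where
  "quotient_dim V I =
     (let R = power_series_ring V;
          Q = R Quot I;
          K = (\<lambda>c. I +>\<^bsub>R\<^esub> series_const c) ` UNIV
      in if \<exists>d. ring.dimension Q d K (carrier Q)
         then enat (THE d. ring.dimension Q d K (carrier Q)) else \<infinity>)"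

text \<open>The coefficient function of a polynomial \<open>g\<close> is its Taylor series at 0.\<close>

definition milnor_number :: "'n set \<Rightarrow> 'n cpoly \<Rightarrow> enat" where
  "milnor_number V g = quotient_dim V
     (Idl\<^bsub>power_series_ring V\<^esub> ((\<lambda>i. Poly_Mapping.lookup (pderiv_wrt i g)) ` V))"

definition tjurina_number :: "'n set \<Rightarrow> 'n cpoly \<Rightarrow> enat" where
  "tjurina_number V g = quotient_dim V
     (Idl\<^bsub>power_series_ring V\<^esub> (insert (Poly_Mapping.lookup g) ((\<lambda>i. Poly_Mapping.lookup (pderiv_wrt i g)) ` V)))"

section \<open>Transversal singularities\<close>

definition cstar_orbit :: "('n::finite \<Rightarrow> nat) \<Rightarrow> complex ^ 'n \<Rightarrow> (complex ^ 'n) set" where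
  "cstar_orbit w x = {(\<chi> i. inverse (u ^ w i) * x $ i) | u. u \<noteq> 0}"

definition singular_orbits ::
    "('n::finite \<Rightarrow> nat) \<Rightarrow> 'n cpoly \<Rightarrow> (complex ^ 'n) set set" where
  "singular_orbits w F = cstar_orbit w ` (crit_locus F - {0})"

text \<open>
  Instead of permuting coordinates so that the last one of \<open>a\<close> is nonzero, we name the
  coordinate \<open>p\<close> with \<open>a\<^sub>p \<noteq> 0\<close> that is frozen; the germ lives in the variables \<open>y\<^sub>i\<close>, \<open>i \<noteq> p\<close>.
\<close>

definition transversal_germ :: "'n::finite cpoly \<Rightarrow> complex ^ 'n \<Rightarrow> 'n \<Rightarrow> 'n cpoly" where
  "transversal_germ F a p =
     psubst F (\<lambda>i. if i = p then pconst (a $ p) else pvar i + pconst (a $ i))"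

text \<open>
  The isomorphism type of a transversal singularity does not depend on the representative \<open>a\<close>
  of the orbit or on \<open>p\<close>. Only one choice per orbit is required to satisfy the equality, so a
  theorem assuming this predicate applies to whichever choices were made.
\<close>

definition transversal_milnor_eq_tjurina :: "('n::finite \<Rightarrow> nat) \<Rightarrow> 'n cpoly \<Rightarrow> bool" where
  "transversal_milnor_eq_tjurina w F \<longleftrightarrow>
     (\<forall>orb\<in>singular_orbits w F. \<exists>a\<in>orb. \<exists>p. a $ p \<noteq> 0 \<and>
        milnor_number (- {p}) (transversal_germ F a p) =
        tjurina_number (- {p}) (transversal_germ F a p))"

end

theory Submission
  imports Defs
begin

text \<open>
  Let \<open>V(x) = f(x) - \<Sum>\<^sub>i x\<^sub>i \<partial>\<^sub>i f(x)\<close> be the Legendre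
  function, so that \<open>dV = - \<Sum>\<^sub>i x\<^sub>i d(\<partial>\<^sub>i f)\<close>. Eliminating \<open>f\<^sub>N\<close> with Euler's formula shows that along a
  sequence \<open>x \<rightarrow> \<infinity>\<close> with \<open>\<partial>f(x) \<rightarrow> 0\<close> the size of \<open>V(x)\<close> is at least that of \<open>R\<^sup>N\<^sup>-\<^sup>k\<close>, where \<open>R\<close> is the
  weighted radius of \<open>x\<close>; as \<open>w\<^sub>i \<le> N - k\<close>, this gives \<open>\<parallel>x\<parallel> \<le> C \<bar>V(x)\<bar>\<close>. Hence \<open>log V\<close> is Lipschitz as a
  function of \<open>\<partial>f\<close>, and lifting a short segment under \<open>\<partial>f\<close> hardly changes the size of \<open>V\<close>.

  If \<open>f\<close> were not tame, there would be arbitrarily many points with small gradient and widely separated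
  values of \<open>V\<close>. After a small generic perturbation by a diagonal quadratic form the segments from
  their gradients to a common generic \<open>q\<close> lift through points with nondegenerate Hessian, and
  their endpoints are nondegenerate solutions of \<open>\<partial>f = q\<close> with distinct values of \<open>V\<close>. Counting
  monomials yields an algebraic relation between \<open>\<partial>f\<close> and \<open>V\<close> whose degree depends only on the degree
  of \<open>f\<close>, so the number of such solutions is bounded.
\<close>


section \<open>Evaluation and weights\<close>

definition monom_at :: "('n::finite \<Rightarrow>\<^sub>0 nat) \<Rightarrow> complex ^ 'n \<Rightarrow> complex" where
  "monom_at m x = (\<Prod>i\<in>UNIV. x $ i ^ Poly_Mapping.lookup m i)"

lemma peval_superset:
  assumes "finite S" "Poly_Mapping.keys f \<subseteq> S"
  shows "peval f x = (\<Sum>m\<in>S. Poly_Mapping.lookup f m * monom_at m x)"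
  unfolding peval_def monom_at_def
  using assms by (intro sum.mono_neutral_left) (auto simp: in_keys_iff)

lemma peval_zero [simp]: "peval 0 x = 0"
  by (simp add: peval_def)

lemma peval_add: "peval (f + g) x = peval f x + peval g x"
proof -
  let ?S = "Poly_Mapping.keys f \<union> Poly_Mapping.keys g"
  have "Poly_Mapping.keys (f + g) \<subseteq> ?S" by (rule keys_add)
  then show ?thesis
    by (simp add: peval_superset[where S = ?S] lookup_add algebra_simps sum.distrib)
qed

lemma peval_single: "peval (Poly_Mapping.single m c) x = c * monom_at m x"
  by (simp add: peval_superset[where S = "{m}"])

lemma peval_sum: "peval (\<Sum>m\<in>S. g m) x = (\<Sum>m\<in>S. peval (g m) x)"
  by (induction S rule: infinite_finite_induct) (auto simp: peval_add)

lemma peval_pderiv_superset: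
  assumes "finite S" "Poly_Mapping.keys f \<subseteq> S"
  shows "peval (pderiv_wrt i f) x =
    (\<Sum>m\<in>S. of_nat (Poly_Mapping.lookup m i) * Poly_Mapping.lookup f m * monom_at (m - Poly_Mapping.single i 1) x)"
proof -
  have "peval (pderiv_wrt i f) x = (\<Sum>m\<in>Poly_Mapping.keys f.
      of_nat (Poly_Mapping.lookup m i) * Poly_Mapping.lookup f m * monom_at (m - Poly_Mapping.single i 1) x)"
    by (simp add: pderiv_wrt_def peval_sum peval_single)
  also have "\<dots> = (\<Sum>m\<in>S. of_nat (Poly_Mapping.lookup m i) * Poly_Mapping.lookup f m * monom_at (m - Poly_Mapping.single i 1) x)"
    using assms by (intro sum.mono_neutral_left) (auto simp: in_keys_iff)
  finally show ?thesis .
qed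

lemma lookup_wpart:
  "Poly_Mapping.lookup (wpart w d f) m = (if wdeg w m = d then Poly_Mapping.lookup f m else 0)"
  by (auto simp: wpart_def lookup_sum lookup_single when_def sum.delta' in_keys_iff)

lemma keys_wpart: "Poly_Mapping.keys (wpart w d f) = {m \<in> Poly_Mapping.keys f. wdeg w m = d}"
  by (auto simp: in_keys_iff lookup_wpart split: if_splits)

lemma sum_wpart:
  assumes "\<And>m. m \<in> Poly_Mapping.keys f \<Longrightarrow> wdeg w m \<le> N"
  shows "(\<Sum>d\<le>N. wpart w d f) = f"
proof (rule poly_mapping_eqI)
  fix m
  have "Poly_Mapping.lookup f m = 0" if "\<not> wdeg w m \<le> N"
    using assms that by (meson in_keys_iff)
  then show "Poly_Mapping.lookup (\<Sum>d\<le>N. wpart w d f) m = Poly_Mapping.lookup f m"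
    by (auto simp: lookup_sum lookup_wpart)
qed

lemma pderiv_wrt_add: "pderiv_wrt i (f + g) = pderiv_wrt i f + pderiv_wrt i g"
proof -
  define S where "S = Poly_Mapping.keys f \<union> Poly_Mapping.keys g"
  define D where "D h m = Poly_Mapping.single (m - Poly_Mapping.single i (1::nat))
      (of_nat (Poly_Mapping.lookup m i) * Poly_Mapping.lookup h m :: complex)" for h m
  have *: "pderiv_wrt i h = (\<Sum>m\<in>S. D h m)" if "Poly_Mapping.keys h \<subseteq> S" for h
    unfolding pderiv_wrt_def D_def
    using that by (intro sum.mono_neutral_left) (auto simp: in_keys_iff S_def)
  have "Poly_Mapping.keys (f + g) \<subseteq> S" unfolding S_def by (rule keys_add)
  then have "pderiv_wrt i (f + g) = (\<Sum>m\<in>S. D f m + D g m)"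
    by (simp add: * D_def lookup_add algebra_simps single_add)
  also have "\<dots> = pderiv_wrt i f + pderiv_wrt i g"
    by (simp add: sum.distrib * S_def)
  finally show ?thesis .
qed

lemma pderiv_wrt_sum: "pderiv_wrt i (\<Sum>d\<in>S. g d) = (\<Sum>d\<in>S. pderiv_wrt i (g d))"
proof -
  have "pderiv_wrt i 0 = 0" by (simp add: pderiv_wrt_def)
  then show ?thesis
    by (induction S rule: infinite_finite_induct) (simp_all add: pderiv_wrt_add)
qed

lemma monom_at_diff_single:
  assumes "Poly_Mapping.lookup m i \<noteq> 0"
  shows "monom_at m x = x $ i * monom_at (m - Poly_Mapping.single i 1) x"
proof -
  have "monom_at m x = x $ i ^ Poly_Mapping.lookup m i * (\<Prod>j\<in>UNIV-{i}. x $ j ^ Poly_Mapping.lookup m j)"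
    unfolding monom_at_def by (subst prod.remove[of _ i]) auto
  moreover have "monom_at (m - Poly_Mapping.single i 1) x =
      x $ i ^ (Poly_Mapping.lookup m i - 1) * (\<Prod>j\<in>UNIV-{i}. x $ j ^ Poly_Mapping.lookup m j)"
    unfolding monom_at_def
    by (subst prod.remove[of _ i]) (auto simp: lookup_minus lookup_single when_def intro!: prod.cong)
  ultimately show ?thesis
    using assms by (cases "Poly_Mapping.lookup m i") auto
qed

lemma monom_at_diff_single_mult:
  "of_nat (Poly_Mapping.lookup m i) * (x $ i * monom_at (m - Poly_Mapping.single i 1) x) =
   of_nat (Poly_Mapping.lookup m i) * monom_at m x"
  by (cases "Poly_Mapping.lookup m i = 0") (auto simp: monom_at_diff_single[of m i])

text \<open>For nonzero \<open>r\<close> this is the action of \<open>inverse r\<close> in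
  \<open>cstar_orbit\<close>, so that a nonzero point goes to infinity as real \<open>r\<close>
  does.\<close>

definition wscale :: "('n::finite \<Rightarrow> nat) \<Rightarrow> complex \<Rightarrow> complex ^ 'n \<Rightarrow> complex ^ 'n" where
  "wscale w r y = (\<chi> i. r ^ w i * y $ i)"

lemma monom_at_wscale: "monom_at m (wscale w r y) = r ^ wdeg w m * monom_at m y"
  by (simp add: monom_at_def wscale_def wdeg_def power_mult_distrib prod.distrib power_sum power_mult)

lemma wdeg_diff_single:
  assumes "Poly_Mapping.lookup m i \<noteq> 0"
  shows "w i + wdeg w (m - Poly_Mapping.single i 1) = wdeg w m"
proof -
  have "wdeg w m = w i * Poly_Mapping.lookup m i + (\<Sum>j\<in>UNIV-{i}. w j * Poly_Mapping.lookup m j)"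
    unfolding wdeg_def by (subst sum.remove[of _ i]) auto
  moreover have "wdeg w (m - Poly_Mapping.single i 1) =
      w i * (Poly_Mapping.lookup m i - 1) + (\<Sum>j\<in>UNIV-{i}. w j * Poly_Mapping.lookup m j)"
    unfolding wdeg_def
    by (subst sum.remove[of _ i]) (auto simp: lookup_minus lookup_single when_def intro!: sum.cong)
  ultimately show ?thesis
    using assms by (cases "Poly_Mapping.lookup m i") auto
qed

lemma peval_wpart_wscale:
  "peval (wpart w d f) (wscale w r y) = r ^ d * peval (wpart w d f) y"
  by (auto simp: peval_superset[OF finite_keys order_refl] keys_wpart monom_at_wscale
      sum_distrib_left algebra_simps intro!: sum.cong)

text \<open>The derivative is weighted homogeneous of degree \<open>d - w i\<close>. Keeping
  \<open>r ^ w i\<close> on the left avoids a truncated exponent and a division by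
  \<open>r\<close>.\<close>

lemma peval_pderiv_wpart_wscale:
  "r ^ w i * peval (pderiv_wrt i (wpart w d f)) (wscale w r y) =
   r ^ d * peval (pderiv_wrt i (wpart w d f)) y"
proof -
  have "r ^ w i * (of_nat (Poly_Mapping.lookup m i) * monom_at (m - Poly_Mapping.single i 1) (wscale w r y))
      = r ^ wdeg w m * (of_nat (Poly_Mapping.lookup m i) * monom_at (m - Poly_Mapping.single i 1) y)" for m
  proof (cases "Poly_Mapping.lookup m i = 0")
    case False
    then show ?thesis
      using wdeg_diff_single[OF False, of w] by (simp add: monom_at_wscale flip: power_add)
  qed auto
  note * = this
  have "r ^ w i * (of_nat (Poly_Mapping.lookup m i) * Poly_Mapping.lookup (wpart w d f) m *
        monom_at (m - Poly_Mapping.single i 1) (wscale w r y))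
      = r ^ d * (of_nat (Poly_Mapping.lookup m i) * Poly_Mapping.lookup (wpart w d f) m *
        monom_at (m - Poly_Mapping.single i 1) y)" if "wdeg w m = d" for m
    using arg_cong[OF *[of m], of "(*) (Poly_Mapping.lookup (wpart w d f) m)"] that
    by (simp only: mult_ac)
  then show ?thesis
    unfolding peval_pderiv_superset[OF finite_keys order_refl] sum_distrib_left
    by (intro sum.cong) (simp_all add: keys_wpart)
qed

text \<open>Euler's formula: \<open>x\<^sub>i \<partial>\<^sub>i\<close> multiplies a monomial by
  its exponent in \<open>x\<^sub>i\<close>, so the weighted sum multiplies it by its weighted
  degree.\<close>

lemma euler_wpart:
  "(\<Sum>i\<in>UNIV. of_nat (w i) * (x $ i * peval (pderiv_wrt i (wpart w d f)) x)) =
   of_nat d * peval (wpart w d f) x"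
proof -
  let ?K = "Poly_Mapping.keys (wpart w d f)" and ?c = "Poly_Mapping.lookup (wpart w d f)"
  have "(\<Sum>i\<in>UNIV. of_nat (w i) * (x $ i * peval (pderiv_wrt i (wpart w d f)) x)) =
    (\<Sum>i\<in>UNIV. \<Sum>m\<in>?K. ?c m * (of_nat (w i) *
      (of_nat (Poly_Mapping.lookup m i) * (x $ i * monom_at (m - Poly_Mapping.single i 1) x))))"
    by (simp add: peval_pderiv_superset[OF finite_keys order_refl] sum_distrib_left mult_ac)
  also have "\<dots> = (\<Sum>m\<in>?K. ?c m * (of_nat (wdeg w m) * monom_at m x))"
    unfolding monom_at_diff_single_mult
    by (subst sum.swap) (simp add: wdeg_def sum_distrib_left sum_distrib_right mult_ac)
  also have "\<dots> = of_nat d * peval (wpart w d f) x"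
    by (auto simp: peval_superset[OF finite_keys order_refl] keys_wpart sum_distrib_left intro!: sum.cong)
  finally show ?thesis .
qed

section \<open>Differentiation of polynomial functions\<close>

lemma has_derivative_monom_at:
  "(monom_at m has_derivative
     (\<lambda>v. \<Sum>i\<in>UNIV. of_nat (Poly_Mapping.lookup m i) * monom_at (m - Poly_Mapping.single i 1) x * v $ i)) (at x)"
proof -
  have nth: "((\<lambda>x. x $ i) has_derivative (\<lambda>v. v $ i)) (at x)" for i
    by (rule bounded_linear.has_derivative[OF bounded_linear_vec_nth]) (rule has_derivative_ident)
  have "(monom_at m has_derivative
     (\<lambda>v. \<Sum>i\<in>UNIV. of_nat (Poly_Mapping.lookup m i) * v $ i * x $ i ^ (Poly_Mapping.lookup m i - 1) *
        (\<Prod>j\<in>UNIV-{i}. x $ j ^ Poly_Mapping.lookup m j))) (at x)"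
    unfolding monom_at_def[abs_def]
    by (rule has_derivative_prod) (rule has_derivative_power[OF nth])
  moreover have "monom_at (m - Poly_Mapping.single i 1) x =
      x $ i ^ (Poly_Mapping.lookup m i - 1) * (\<Prod>j\<in>UNIV-{i}. x $ j ^ Poly_Mapping.lookup m j)" for i
    unfolding monom_at_def
    by (subst prod.remove[of _ i]) (auto simp: lookup_minus lookup_single when_def intro!: prod.cong)
  ultimately show ?thesis
    by (simp add: mult_ac)
qed

lemma has_derivative_peval:
  "(peval f has_derivative (\<lambda>v. \<Sum>i\<in>UNIV. peval (pderiv_wrt i f) x * v $ i)) (at x)"
proof -
  let ?K = "Poly_Mapping.keys f"
  have "((\<lambda>x. \<Sum>m\<in>?K. Poly_Mapping.lookup f m * monom_at m x) has_derivative
     (\<lambda>v. \<Sum>m\<in>?K. Poly_Mapping.lookup f m *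
        (\<Sum>i\<in>UNIV. of_nat (Poly_Mapping.lookup m i) * monom_at (m - Poly_Mapping.single i 1) x * v $ i))) (at x)"
    by (intro has_derivative_sum has_derivative_mult_right has_derivative_monom_at)
  moreover have "(\<Sum>m\<in>?K. Poly_Mapping.lookup f m *
        (\<Sum>i\<in>UNIV. of_nat (Poly_Mapping.lookup m i) * monom_at (m - Poly_Mapping.single i 1) x * v $ i))
     = (\<Sum>i\<in>UNIV. peval (pderiv_wrt i f) x * v $ i)" for v :: "complex ^ 'a"
    by (simp add: peval_pderiv_superset[OF finite_keys order_refl] sum_distrib_left sum_distrib_right mult_ac)
      (rule sum.swap)
  ultimately show ?thesis
    by (simp add: peval_superset[OF finite_keys order_refl, abs_def])
qed

lemma continuous_on_peval [continuous_intros]: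
  assumes "continuous_on S g"
  shows "continuous_on S (\<lambda>x. peval f (g x))"
proof -
  have "continuous_on UNIV (peval f)"
    by (intro continuous_at_imp_continuous_on ballI has_derivative_continuous[OF has_derivative_peval])
  then show ?thesis
    using assms by (rule continuous_on_compose2) auto
qed

section \<open>Algebraic relations by counting monomials\<close>

text \<open>Gaussian elimination: if some \<open>c a0 b\<close> is nonzero, equation
  \<open>b\<close> expresses the unknown at \<open>a0\<close> by the others, and substitution leaves
  one equation and one unknown fewer.\<close>

lemma homogeneous_system_nontrivial_solution:
  fixes c :: "'a \<Rightarrow> 'b \<Rightarrow> 'k::field"
  assumes "finite B" "finite A" "card B < card A"
  shows "\<exists>\<kappa>. (\<exists>a\<in>A. \<kappa> a \<noteq> 0) \<and> (\<forall>b\<in>B. (\<Sum>a\<in>A. \<kappa> a * c a b) = 0)"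
  using assms
proof (induction B arbitrary: A c rule: finite_induct)
  case empty
  then obtain a where "a \<in> A" by fastforce
  then show ?case by (intro exI[of _ "\<lambda>_. 1"]) auto
next
  case (insert b B)
  show ?case
  proof (cases "\<forall>a\<in>A. c a b = 0")
    case True
    moreover have "card B < card A" using insert by simp
    ultimately show ?thesis
      using insert.IH[of A c] insert.prems by auto
  next
    case False
    then obtain a0 where a0: "a0 \<in> A" "c a0 b \<noteq> 0" by blast
    define A' where "A' = A - {a0}"
    have A': "finite A'" "card B < card A'" "a0 \<notin> A'" "A = insert a0 A'"
      using insert a0 by (auto simp: A'_def)
    obtain \<kappa> where \<kappa>: "\<exists>a\<in>A'. \<kappa> a \<noteq> 0"
      and eq: "\<And>b'. b' \<in> B \<Longrightarrow> (\<Sum>a\<in>A'. \<kappa> a * (c a b' - c a b / c a0 b * c a0 b')) = 0"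
      using insert.IH[OF A'(1,2), of "\<lambda>a b'. c a b' - c a b / c a0 b * c a0 b'"] by blast
    define s where "s = - (\<Sum>a\<in>A'. \<kappa> a * c a b) / c a0 b"
    define \<kappa>' where "\<kappa>' = \<kappa>(a0 := s)"
    have sum: "(\<Sum>a\<in>A. \<kappa>' a * c a b') = s * c a0 b' + (\<Sum>a\<in>A'. \<kappa> a * c a b')" for b'
    proof -
      have "(\<Sum>a\<in>A'. \<kappa>' a * c a b') = (\<Sum>a\<in>A'. \<kappa> a * c a b')"
        using A'(3) by (intro sum.cong) (auto simp: \<kappa>'_def)
      then show ?thesis
        using A' by (simp add: \<kappa>'_def)
    qed
    have "(\<Sum>a\<in>A. \<kappa>' a * c a b') = 0" if "b' \<in> insert b B" for b'
    proof (cases "b' = b")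
      case True
      then show ?thesis using a0 by (simp add: sum s_def)
    next
      case False
      then have "0 = (\<Sum>a\<in>A'. \<kappa> a * c a b' - \<kappa> a * c a b * (c a0 b' / c a0 b))"
        using eq[of b'] that by (simp add: algebra_simps)
      also have "\<dots> = (\<Sum>a\<in>A. \<kappa>' a * c a b')"
        unfolding sum by (simp add: s_def sum_subtractf sum_distrib_right[symmetric]
            times_divide_eq_right[symmetric] del: times_divide_eq_right)
      finally show ?thesis by simp
    qed
    moreover have "\<exists>a\<in>A. \<kappa>' a \<noteq> 0"
      using \<kappa> A' by (auto simp: \<kappa>'_def)
    ultimately show ?thesis by blast
  qed
qed

section \<open>Polynomial functions of bounded degree in each variable\<close>

abbreviation exponent_box :: "nat \<Rightarrow> ('n::finite \<Rightarrow> nat) set" where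
  "exponent_box d \<equiv> UNIV \<rightarrow>\<^sub>E {..d}"

lemma finite_exponent_box: "finite (exponent_box d)" and card_exponent_box: "card (exponent_box d :: ('n::finite \<Rightarrow> nat) set) = (d + 1) ^ CARD('n)"
  by (auto intro!: finite_PiE simp: card_PiE)

text \<open>Bounding each exponent separately makes the admissible monomials a product set, which is
  easy to count.\<close>

definition box_poly :: "nat \<Rightarrow> (complex ^ 'n::finite \<Rightarrow> complex) \<Rightarrow> bool" where
  "box_poly d \<phi> \<longleftrightarrow> (\<exists>c. \<forall>x. \<phi> x = (\<Sum>m\<in>exponent_box d. c m * (\<Prod>i\<in>UNIV. x $ i ^ m i)))"

lemma box_poly_add: "box_poly d \<phi> \<Longrightarrow> box_poly d \<psi> \<Longrightarrow> box_poly d (\<lambda>x. \<phi> x + \<psi> x)"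
  unfolding box_poly_def
proof (elim exE, goal_cases)
  case (1 c c')
  then show ?case
    by (intro exI[of _ "\<lambda>m. c m + c' m"]) (simp add: algebra_simps sum.distrib)
qed

lemma box_poly_cmult: "box_poly d \<phi> \<Longrightarrow> box_poly d (\<lambda>x. a * \<phi> x)"
  unfolding box_poly_def
proof (elim exE, goal_cases)
  case (1 c)
  then show ?case
    by (intro exI[of _ "\<lambda>m. a * c m"]) (simp add: algebra_simps sum_distrib_left)
qed

lemma box_poly_zero: "box_poly d (\<lambda>x. 0)"
  unfolding box_poly_def by (intro exI[of _ "\<lambda>_. 0"]) simp

lemma box_poly_sum: "(\<And>a. a \<in> A \<Longrightarrow> box_poly d (\<phi> a)) \<Longrightarrow> box_poly d (\<lambda>x. \<Sum>a\<in>A. \<phi> a x)"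
  by (induction A rule: infinite_finite_induct) (auto intro: box_poly_zero box_poly_add)

lemma box_poly_monomial:
  assumes "\<And>i. m i \<le> d"
  shows "box_poly d (\<lambda>x. \<Prod>i\<in>UNIV. x $ i ^ m i)"
proof -
  have "m \<in> exponent_box d" using assms by auto
  then have "(\<Sum>m'\<in>exponent_box d. (if m' = m then 1 else 0) * (\<Prod>i\<in>UNIV. x $ i ^ m' i)) = (\<Prod>i\<in>UNIV. x $ i ^ m i)"
    for x :: "complex ^ 'a"
    by (simp add: if_distrib[of "\<lambda>a. a * _"] sum.delta finite_exponent_box cong: if_cong)
  then show ?thesis
    unfolding box_poly_def by (intro exI[of _ "\<lambda>m'. if m' = m then 1 else 0"]) simp
qed

lemma box_poly_mono:
  assumes "box_poly d \<phi>" "d \<le> e"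
  shows "box_poly e \<phi>"
proof -
  obtain c where c: "\<And>x. \<phi> x = (\<Sum>m\<in>exponent_box d. c m * (\<Prod>i\<in>UNIV. x $ i ^ m i))"
    using assms unfolding box_poly_def by auto
  show ?thesis
    unfolding c using assms(2)
    by (intro box_poly_sum box_poly_cmult box_poly_monomial) (auto simp: PiE_UNIV_domain Pi_def intro: order_trans)
qed

lemma box_poly_mult:
  assumes "box_poly d \<phi>" "box_poly e \<psi>"
  shows "box_poly (d + e) (\<lambda>x. \<phi> x * \<psi> x)"
proof -
  obtain c where c: "\<And>x. \<phi> x = (\<Sum>m\<in>exponent_box d. c m * (\<Prod>i\<in>UNIV. x $ i ^ m i))"
    using assms unfolding box_poly_def by auto
  obtain c' where c': "\<And>x. \<psi> x = (\<Sum>m\<in>exponent_box e. c' m * (\<Prod>i\<in>UNIV. x $ i ^ m i))"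
    using assms unfolding box_poly_def by auto
  have "\<phi> x * \<psi> x = (\<Sum>m\<in>exponent_box d. \<Sum>m'\<in>exponent_box e. (c m * c' m') * (\<Prod>i\<in>UNIV. x $ i ^ (m i + m' i)))" for x
    unfolding c c' sum_product by (simp add: power_add prod.distrib mult_ac)
  then show ?thesis
    by (simp only:) (intro box_poly_sum box_poly_cmult box_poly_monomial,
        auto simp: PiE_UNIV_domain Pi_def intro!: add_mono)
qed

lemma box_poly_one: "box_poly 0 (\<lambda>x. 1)"
  using box_poly_monomial[of "\<lambda>_. 0" 0] by simp

lemma box_poly_nth: "box_poly 1 (\<lambda>x. x $ i)"
proof -
  have "(\<Prod>j\<in>UNIV. x $ j ^ (if j = i then 1 else 0)) = x $ i" for x :: "complex ^ 'a"
    by (subst prod.remove[of _ i]) auto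
  then show ?thesis
    using box_poly_monomial[of "\<lambda>j. if j = i then 1 else 0" 1] by simp
qed

lemma box_poly_power: "box_poly d \<phi> \<Longrightarrow> box_poly (d * k) (\<lambda>x. \<phi> x ^ k)"
  by (induction k) (auto intro: box_poly_one box_poly_mult)

lemma box_poly_prod:
  "finite A \<Longrightarrow> (\<And>a. a \<in> A \<Longrightarrow> box_poly d (\<phi> a)) \<Longrightarrow> box_poly (d * card A) (\<lambda>x. \<Prod>a\<in>A. \<phi> a x)"
  by (induction A rule: finite_induct) (auto intro: box_poly_one box_poly_mult)

text \<open>A dimension count: the products of powers of the \<open>P x $ i\<close> and
  \<open>W x\<close> with exponents at most \<open>M\<close> have degree at most \<open>E\<close> in
  each variable. There are \<open>(M + 1) ^ (CARD('n) + 1)\<close> of them, more than there are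
  monomials, so a nontrivial linear combination vanishes.\<close>

lemma algebraic_relation:
  fixes P :: "complex ^ 'n::finite \<Rightarrow> complex ^ 'n" and W :: "complex ^ 'n \<Rightarrow> complex"
  assumes P: "\<And>i. box_poly d (\<lambda>x. P x $ i)" and W: "box_poly d W"
    and M: "M = (d * (CARD('n) + 1) + 1) ^ CARD('n)"
  obtains Q :: "('n \<Rightarrow> nat) \<Rightarrow> nat \<Rightarrow> complex"
  where "\<exists>\<alpha>\<in>exponent_box M. \<exists>j\<le>M. Q \<alpha> j \<noteq> 0"
    and "\<And>x. (\<Sum>j\<le>M. (\<Sum>\<alpha>\<in>exponent_box M. Q \<alpha> j * (\<Prod>i\<in>UNIV. (P x $ i) ^ \<alpha> i)) * W x ^ j) = 0"
proof -
  define E where "E = d * (CARD('n) + 1) * M"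
  define \<phi> where "\<phi> = (\<lambda>(\<alpha>, j) x. (\<Prod>i\<in>UNIV. (P x $ i) ^ \<alpha> i) * W x ^ j)"
  have "box_poly E (\<phi> (\<alpha>, j))" if "\<alpha> \<in> exponent_box M" "j \<le> M" for \<alpha> j
  proof -
    have "box_poly (d * M) (\<lambda>x. (P x $ i) ^ \<alpha> i)" for i
      using that by (intro box_poly_mono[OF box_poly_power[OF P]]) auto
    then have "box_poly (d * M * CARD('n)) (\<lambda>x. \<Prod>i\<in>UNIV. (P x $ i) ^ \<alpha> i)"
      by (intro box_poly_prod) auto
    moreover have "box_poly (d * M) (\<lambda>x. W x ^ j)"
      using that by (intro box_poly_mono[OF box_poly_power[OF W]]) auto
    ultimately have "box_poly (d * M * CARD('n) + d * M) (\<phi> (\<alpha>, j))"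
      unfolding \<phi>_def prod.case by (rule box_poly_mult)
    then show ?thesis by (simp add: E_def algebra_simps)
  qed
  then have box_poly: "\<forall>a\<in>exponent_box M \<times> {..M}. box_poly E (\<phi> a)"
    by blast
  then obtain c where c: "\<And>a x. a \<in> exponent_box M \<times> {..M} \<Longrightarrow>
      \<phi> a x = (\<Sum>m\<in>exponent_box E. c a m * (\<Prod>i\<in>UNIV. x $ i ^ m i))"
    using bchoice[OF box_poly[unfolded box_poly_def]] by blast
  \<comment> \<open>This estimate dictates \<open>M\<close>: the first factor contributes exactly
    \<open>M\<close> after taking the power, so \<open>M * (M + 1) ^ CARD('n)\<close> falls short of
    the number of products.\<close>
  have "card (exponent_box E :: ('n \<Rightarrow> nat) set) \<le> ((d * (CARD('n) + 1) + 1) * (M + 1)) ^ CARD('n)"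
    unfolding card_exponent_box by (rule power_mono) (auto simp: E_def algebra_simps)
  also have "\<dots> = M * (M + 1) ^ CARD('n)"
    by (simp only: power_mult_distrib M)
  also have "\<dots> < card ((exponent_box M :: ('n \<Rightarrow> nat) set) \<times> {..M})"
    by (simp add: card_cartesian_product card_exponent_box)
  finally obtain \<kappa> where \<kappa>: "\<exists>a\<in>(exponent_box M :: ('n \<Rightarrow> nat) set) \<times> {..M}. \<kappa> a \<noteq> 0"
    and eq: "\<And>m. m \<in> exponent_box E \<Longrightarrow> (\<Sum>a\<in>exponent_box M \<times> {..M}. \<kappa> a * c a m) = 0"
    using homogeneous_system_nontrivial_solution[of "exponent_box E" "(exponent_box M :: ('n \<Rightarrow> nat) set) \<times> {..M}" c]
    by (auto simp: finite_exponent_box)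
  show ?thesis
  proof
    show "\<exists>\<alpha>\<in>exponent_box M. \<exists>j\<le>M. curry \<kappa> \<alpha> j \<noteq> 0"
      using \<kappa> by auto
    fix x
    have "(\<Sum>j\<le>M. (\<Sum>\<alpha>\<in>exponent_box M. curry \<kappa> \<alpha> j * (\<Prod>i\<in>UNIV. (P x $ i) ^ \<alpha> i)) * W x ^ j)
        = (\<Sum>j\<le>M. \<Sum>\<alpha>\<in>exponent_box M. \<kappa> (\<alpha>, j) * \<phi> (\<alpha>, j) x)"
      by (simp add: \<phi>_def sum_distrib_right mult.assoc)
    also have "\<dots> = (\<Sum>\<alpha>\<in>exponent_box M. \<Sum>j\<le>M. \<kappa> (\<alpha>, j) * \<phi> (\<alpha>, j) x)"
      by (rule sum.swap)
    also have "\<dots> = (\<Sum>a\<in>exponent_box M \<times> {..M}. \<kappa> a * \<phi> a x)"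
      by (simp add: sum.cartesian_product case_prod_unfold)
    also have "\<dots> = (\<Sum>a\<in>exponent_box M \<times> {..M}. \<Sum>m\<in>exponent_box E. (\<kappa> a * c a m) * (\<Prod>i\<in>UNIV. x $ i ^ m i))"
      by (intro sum.cong refl) (simp only: c sum_distrib_left mult.assoc)
    also have "\<dots> = (\<Sum>m\<in>exponent_box E. (\<Sum>a\<in>exponent_box M \<times> {..M}. \<kappa> a * c a m) * (\<Prod>i\<in>UNIV. x $ i ^ m i))"
      unfolding sum_distrib_right by (rule sum.swap)
    also have "\<dots> = 0"
      using eq by simp
    finally show "(\<Sum>j\<le>M. (\<Sum>\<alpha>\<in>exponent_box M. curry \<kappa> \<alpha> j * (\<Prod>i\<in>UNIV. (P x $ i) ^ \<alpha> i)) * W x ^ j) = 0" .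
  qed
qed

text \<open>Induction on the variables: with the others fixed, a polynomial in \<open>x i\<close>
  with infinitely many roots has zero coefficients, and these are polynomials vanishing on the
  smaller product.\<close>

lemma polynomial_vanishing_on_product:
  fixes c :: "('i \<Rightarrow> nat) \<Rightarrow> complex"
  assumes "finite I" "\<And>i. i \<in> I \<Longrightarrow> infinite (S i)"
    and "\<And>x. (\<And>i. i \<in> I \<Longrightarrow> x i \<in> S i) \<Longrightarrow> (\<Sum>m\<in>I \<rightarrow>\<^sub>E {..M}. c m * (\<Prod>i\<in>I. x i ^ m i)) = 0"
    and "m \<in> I \<rightarrow>\<^sub>E {..M}"
  shows "c m = 0"
  using assms
proof (induction I arbitrary: c m rule: finite_induct)
  case empty
  then show ?case by simp
next
  case (insert i I)
  have IH0: "(\<Sum>m\<in>I \<rightarrow>\<^sub>E {..M}. c (m(i := k)) * (\<Prod>j\<in>I. x j ^ m j)) = 0"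
    if x: "\<And>j. j \<in> I \<Longrightarrow> x j \<in> S j" and "k \<le> M" for x k
  proof -
    have "(\<Sum>k\<le>M. (\<Sum>m\<in>I \<rightarrow>\<^sub>E {..M}. c (m(i := k)) * (\<Prod>j\<in>I. x j ^ m j)) * z ^ k) = 0" if "z \<in> S i" for z
    proof -
      let ?x = "x(i := z)"
      have "0 = (\<Sum>m\<in>insert i I \<rightarrow>\<^sub>E {..M}. c m * (\<Prod>j\<in>insert i I. ?x j ^ m j))"
        using that x by (intro insert.prems(2)[symmetric]) auto
      also have "\<dots> = (\<Sum>(k, m)\<in>{..M} \<times> (I \<rightarrow>\<^sub>E {..M}). c (m(i := k)) * (\<Prod>j\<in>insert i I. ?x j ^ (m(i := k)) j))"
        using inj_combinator[OF insert.hyps(2), of "\<lambda>_. {..M}"]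
        by (simp only: PiE_insert_eq) (subst sum.reindex, auto simp: case_prod_unfold)
      also have "\<dots> = (\<Sum>(k, m)\<in>{..M} \<times> (I \<rightarrow>\<^sub>E {..M}). c (m(i := k)) * (\<Prod>j\<in>I. x j ^ m j) * z ^ k)"
      proof (intro sum.cong refl, clarify)
        fix k m
        have "(\<Prod>j\<in>I. ?x j ^ (m(i := k)) j) = (\<Prod>j\<in>I. x j ^ m j)"
          using insert.hyps by (intro prod.cong) auto
        then show "c (m(i := k)) * (\<Prod>j\<in>insert i I. ?x j ^ (m(i := k)) j) = c (m(i := k)) * (\<Prod>j\<in>I. x j ^ m j) * z ^ k"
          using insert.hyps by (simp add: mult_ac)
      qed
      also have "\<dots> = (\<Sum>k\<le>M. (\<Sum>m\<in>I \<rightarrow>\<^sub>E {..M}. c (m(i := k)) * (\<Prod>j\<in>I. x j ^ m j)) * z ^ k)"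
        by (simp add: sum.cartesian_product sum_distrib_right)
      finally show ?thesis by simp
    qed
    then have "infinite {z. (\<Sum>k\<le>M. (\<Sum>m\<in>I \<rightarrow>\<^sub>E {..M}. c (m(i := k)) * (\<Prod>j\<in>I. x j ^ m j)) * z ^ k) = 0}"
      by (intro infinite_super[OF _ insert.prems(1)[of i]]) auto
    then show ?thesis
      using \<open>k \<le> M\<close>
        polyfun_finite_roots[where n = M and c = "\<lambda>k. \<Sum>m\<in>I \<rightarrow>\<^sub>E {..M}. c (m(i := k)) * (\<Prod>j\<in>I. x j ^ m j)"]
      by simp
  qed
  obtain k m' where m: "k \<le> M" "m' \<in> I \<rightarrow>\<^sub>E {..M}" "m = m'(i := k)"
    using insert.prems(3) by (auto simp: PiE_insert_eq)
  show ?case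
    unfolding m(3)
  proof (rule insert.IH[OF _ _ m(2)])
    show "infinite (S j)" if "j \<in> I" for j
      using insert.prems(1) that by simp
  qed (rule IH0[OF _ m(1)])
qed

section \<open>Generic perturbations\<close>

lemma has_derivative_vec_lambda:
  fixes f :: "'n::finite \<Rightarrow> 'a::real_normed_vector \<Rightarrow> 'b::euclidean_space"
  assumes "\<And>i. (f i has_derivative f' i) (at x within S)"
  shows "((\<lambda>x. \<chi> i. f i x) has_derivative (\<lambda>h. \<chi> i. f' i h)) (at x within S)"
proof (subst has_derivative_componentwise_within, intro ballI)
  fix b :: "'b ^ 'n" assume "b \<in> Basis"
  then obtain i u where b: "b = axis i u" by (auto simp: Basis_vec_def)
  show "((\<lambda>x. (\<chi> i. f i x) \<bullet> b) has_derivative (\<lambda>h. (\<chi> i. f' i h) \<bullet> b)) (at x within S)"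
    unfolding b inner_axis vec_lambda_beta by (intro has_derivative_inner_left assms)
qed

lemma differentiable_vec_lambda:
  fixes f :: "'n::finite \<Rightarrow> 'a::real_normed_vector \<Rightarrow> 'b::euclidean_space"
  assumes "\<And>i. f i differentiable (at x within S)"
  shows "(\<lambda>x. \<chi> i. f i x) differentiable (at x within S)"
  using assms has_derivative_vec_lambda[of f _ x S] unfolding differentiable_def by metis

lemma differentiable_bounded_linear_comp:
  assumes "bounded_linear T" "f differentiable (at x within S)"
  shows "(\<lambda>x. T (f x)) differentiable (at x within S)"
  using assms bounded_linear.has_derivative unfolding differentiable_def by blast

text \<open>
  With \<open>I\<close> the support of the kernel vector \<open>z\<close>, scaled so that \<open>z\<^sub>k = 1\<close>, the entries \<open>a\<^sub>i\<close>, \<open>i \<in> I\<close>, are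
  determined by \<open>x\<close> and \<open>z\<close>. So the set is parametrized by \<open>x\<close> and a vector \<open>m\<close> which holds \<open>z\<^sub>i\<close> for
  \<open>i \<in> I - {k}\<close>, \<open>a\<^sub>i\<close> for \<open>i \<notin> I\<close>, and the real number \<open>t\<close> in position \<open>k\<close>: a real hyperplane.
\<close>

lemma negligible_degenerate_perturbations:
  fixes H :: "complex ^ 'n::finite \<Rightarrow> complex ^ 'n ^ 'n"
    and \<Phi> :: "real \<times> (complex ^ 'n) \<times> (complex ^ 'n) \<Rightarrow> complex ^ 'n"
  assumes H: "\<And>i j x. (\<lambda>x. H x $ i $ j) differentiable (at x)"
    and \<Phi>: "\<And>t x a. t > 0 \<Longrightarrow> \<Phi> differentiable (at (t, x, a))"
  shows "negligible {(\<Phi> (t, x, a), a) | t x a z. t > 0 \<and> z \<noteq> 0 \<and> H x *v z + a * z = 0}"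
proof -
  define Z where "Z I k m = (\<chi> i. if i = k then 1 else if i \<in> I then m $ i else 0)"
    for I k and m :: "complex ^ 'n"
  define A where "A I k v = (\<chi> i. if i \<in> I then - (\<Sum>j\<in>UNIV. H (fst v) $ i $ j * Z I k (snd v) $ j) / Z I k (snd v) $ i
      else snd v $ i)" for I k and v :: "(complex ^ 'n) \<times> (complex ^ 'n)"
  define \<Psi> where "\<Psi> I k v = (\<Phi> (Re (snd v $ k), fst v, A I k v), A I k v)" for I k v
  define S where "S I k = {v. Im (snd v $ k) = 0} \<inter> {v :: (complex ^ 'n) \<times> (complex ^ 'n).
      Re (snd v $ k) > 0 \<and> (\<forall>i\<in>I. i \<noteq> k \<longrightarrow> snd v $ i \<noteq> 0)}" for I k
  \<comment> \<open>A differentiable map between spaces of equal real dimension sends null sets to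
    null sets, and \<open>S I k\<close> lies in a real hyperplane.\<close>
  have neg: "negligible (\<Psi> I k ` S I k)" for I k
  proof (rule negligible_differentiable_image_negligible)
    have "negligible {v :: (complex ^ 'n) \<times> (complex ^ 'n). (0, axis k \<i>) \<bullet> v = 0}"
      by (rule negligible_hyperplane) (simp add: zero_prod_def axis_eq_0_iff)
    moreover have "{v. Im (snd v $ k) = 0} = {v :: (complex ^ 'n) \<times> (complex ^ 'n). (0, axis k \<i>) \<bullet> v = 0}"
      by (auto simp: inner_prod_def inner_axis' inner_complex_def)
    ultimately have "negligible {v :: (complex ^ 'n) \<times> (complex ^ 'n). Im (snd v $ k) = 0}"
      by simp
    then show "negligible (S I k)"
      by (rule negligible_subset) (auto simp: S_def)
    show "\<Psi> I k differentiable_on S I k"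
      unfolding differentiable_on_def
    proof
      fix v assume v: "v \<in> S I k"
      let ?F = "at v within S I k"
      have fst: "fst differentiable ?F" and snd: "(\<lambda>v. snd v $ i) differentiable ?F" for i
        by (auto intro!: bounded_linear_imp_differentiable bounded_linear_fst
            bounded_linear_compose[OF bounded_linear_vec_nth bounded_linear_snd])
      have Z: "(\<lambda>v. Z I k (snd v) $ i) differentiable ?F" for i
        by (cases "i = k"; cases "i \<in> I") (simp_all add: Z_def snd)
      have Hf: "(\<lambda>v. H (fst v) $ i $ j) differentiable ?F" for i j
        by (rule differentiable_compose[OF H fst])
      have Znz: "Z I k (snd v) $ i \<noteq> 0" if "i \<in> I" for i
        using v that by (auto simp: Z_def S_def)
      have comp: "(\<lambda>v. if i \<in> I then - (\<Sum>j\<in>UNIV. H (fst v) $ i $ j * Z I k (snd v) $ j) / Z I k (snd v) $ i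
          else snd v $ i) differentiable ?F" for i
      proof (cases "i \<in> I")
        case True
        then show ?thesis
          by (simp only: if_True) (intro differentiable_divide differentiable_minus differentiable_sum
              finite_class.finite_UNIV ballI differentiable_mult Hf Z Znz[OF True])
      qed (simp add: snd)
      have A: "A I k differentiable ?F"
        unfolding A_def[abs_def] by (rule differentiable_vec_lambda[OF comp])
      have t: "(\<lambda>v. Re (snd v $ k)) differentiable ?F"
        using bounded_linear_Re snd by (rule differentiable_bounded_linear_comp)
      have args: "(\<lambda>v. (Re (snd v $ k), fst v, A I k v)) differentiable ?F"
        using t differentiable_Pair[OF fst A] by (rule differentiable_Pair)
      have "\<Phi> differentiable (at (Re (snd v $ k), fst v, A I k v))"
        using v by (intro \<Phi>) (simp add: S_def)
      then have "(\<lambda>v. \<Phi> (Re (snd v $ k), fst v, A I k v)) differentiable ?F"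
        using args by (rule differentiable_compose)
      then show "\<Psi> I k differentiable ?F"
        unfolding \<Psi>_def[abs_def] by (rule differentiable_Pair[OF _ A])
    qed
  qed auto
  have "negligible (\<Union>I. \<Union>k. \<Psi> I k ` S I k)"
    using neg by (intro negligible_Union) auto
  moreover have "{(\<Phi> (t, x, a), a) | t x a z. t > 0 \<and> z \<noteq> 0 \<and> H x *v z + a * z = 0} \<subseteq> (\<Union>I. \<Union>k. \<Psi> I k ` S I k)"
  proof clarify
    fix t x a z assume t: "t > (0::real)" and "z \<noteq> 0" and eq: "H x *v z + a * z = 0"
    then obtain k where k: "z $ k \<noteq> 0" by (auto simp: vec_eq_iff)
    define I where "I = {i. z $ i \<noteq> 0}"
    define m where "m = (\<chi> i. if i = k then complex_of_real t else if i \<in> I then z $ i / z $ k else a $ i)"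
    have Z: "Z I k m $ i = z $ i / z $ k" for i
      using k by (auto simp: Z_def m_def I_def)
    have "A I k (x, m) $ i = a $ i" for i
    proof (cases "i \<in> I")
      case True
      \<comment> \<open>Row \<open>i\<close> of the kernel equation is solved for
        \<open>a $ i\<close>, as \<open>z $ i\<close> is nonzero. The equation is homogeneous in
        \<open>z\<close>, so \<open>z\<close> may be divided by \<open>z $ k\<close>.\<close>
      have "(\<Sum>j\<in>UNIV. H x $ i $ j * z $ j) + a $ i * z $ i = 0"
        using arg_cong[OF eq, of "\<lambda>v. v $ i"] by (simp add: matrix_vector_mult_def)
      then have "(\<Sum>j\<in>UNIV. H x $ i $ j * z $ j) = - (a $ i * z $ i)"
        by (rule eq_neg_iff_add_eq_0[THEN iffD2])
      moreover have "(\<Sum>j\<in>UNIV. H x $ i $ j * Z I k m $ j) = (\<Sum>j\<in>UNIV. H x $ i $ j * z $ j) / z $ k"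
        unfolding Z by (simp add: sum_divide_distrib)
      moreover have "z $ i \<noteq> 0" using True by (simp add: I_def)
      ultimately show ?thesis
        using True k by (simp add: A_def Z)
    next
      case False
      then show ?thesis using k by (auto simp: A_def m_def I_def)
    qed
    then have "A I k (x, m) = a" by (simp add: vec_eq_iff)
    moreover have "m $ k = t" by (simp add: m_def)
    ultimately have "\<Psi> I k (x, m) = (\<Phi> (t, x, a), a)"
      by (simp add: \<Psi>_def)
    moreover have "(x, m) \<in> S I k"
      using t k by (auto simp: S_def m_def I_def)
    ultimately show "(\<Phi> (t, x, a), a) \<in> (\<Union>I. \<Union>k. \<Psi> I k ` S I k)"
      by (intro UN_I[OF UNIV_I[of I]] UN_I[OF UNIV_I[of k]] image_eqI[where x = "(x, m)"]) simp_all
  qed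
  ultimately show ?thesis
    by (rule negligible_subset)
qed

section \<open>Lifting segments\<close>

text \<open>The pairing is complex bilinear, without conjugation, because it pairs points with
  gradients of holomorphic functions.\<close>

definition cdot :: "complex ^ 'n::finite \<Rightarrow> complex ^ 'n \<Rightarrow> complex" where
  "cdot x y = (\<Sum>i\<in>UNIV. x $ i * y $ i)"

lemma norm_cdot_le: "norm (cdot x y) \<le> real CARD('n) * (norm x * norm (y :: complex ^ 'n::finite))"
proof -
  have "norm (cdot x y) \<le> (\<Sum>i\<in>(UNIV :: 'n set). norm x * norm y)"
    unfolding cdot_def
    by (intro sum_norm_le) (auto simp: norm_mult intro!: mult_mono component_le_norm_cart Finite_Cartesian_Product.norm_nth_le)
  then show ?thesis by simp
qed

text \<open>An injective endomorphism in finite dimension is invertible, so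
  \<open>inverse_function_theorem\<close> applies; its local inverse is kept as a section of
  \<open>P\<close> through \<open>x\<close>.\<close>

lemma local_inverse:
  fixes P :: "'a::euclidean_space \<Rightarrow> 'a" and P' :: "'a \<Rightarrow> ('a \<Rightarrow>\<^sub>L 'a)"
  assumes "\<And>x. (P has_derivative blinfun_apply (P' x)) (at x)"
    and "continuous_on UNIV P'" and "inj (blinfun_apply (P' x))"
  obtains W g where "open W" "P x \<in> W" "g (P x) = x" "continuous_on W g"
    "\<And>y. y \<in> W \<Longrightarrow> P (g y) = y"
    "(g has_derivative inv_into UNIV (blinfun_apply (P' x))) (at (P x))"
proof -
  have lin: "linear (blinfun_apply (P' x))"
    by (simp add: bounded_linear.linear blinfun.bounded_linear_right)
  then obtain h where h: "linear h" "h \<circ> blinfun_apply (P' x) = id"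
    using assms(3) linear_injective_left_inverse by blast
  then have "bounded_linear h"
    by (simp add: linear_conv_bounded_linear)
  then have "Blinfun h o\<^sub>L P' x = id_blinfun"
    using h(2) by (intro blinfun_eqI) (simp add: bounded_linear_Blinfun_apply fun_eq_iff)
  from inverse_function_theorem[OF open_UNIV assms(1,2) UNIV_I this]
  obtain U' W g g' where g: "open U'" "x \<in> U'" "open W" "P x \<in> W" "homeomorphism U' W P g"
    "\<And>y. y \<in> W \<Longrightarrow> (g has_derivative (g' y)) (at y)"
    "\<And>y. y \<in> W \<Longrightarrow> g' y = inv_into UNIV (blinfun_apply (P' (g y)))"
    "\<And>y. y \<in> W \<Longrightarrow> bij (blinfun_apply (P' (g y)))"
    by (metis UNIV_I)
  moreover have "g (P x) = x"
    using g(2,5) by (simp add: homeomorphism_def)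
  ultimately show ?thesis
    using that[of W g] by (metis homeomorphism_cont2 homeomorphism_apply2)
qed

text \<open>
  The set of times up to which the segment lifts is compact, and it is open to the right by the
  local inverse. The growth assumption keeps the lift in the ball of radius \<open>\<rho>\<close>.
\<close>

lemma lift_segment:
  fixes P :: "complex ^ 'n::finite \<Rightarrow> complex ^ 'n" and P' :: "complex ^ 'n \<Rightarrow> ((complex ^ 'n) \<Rightarrow>\<^sub>L (complex ^ 'n))"
    and V :: "complex ^ 'n \<Rightarrow> complex"
  assumes dP: "\<And>x. (P has_derivative blinfun_apply (P' x)) (at x)"
    and contP': "continuous_on UNIV P'"
    and dV: "\<And>x. (V has_derivative (\<lambda>v. - cdot x (P' x v))) (at x)"
    and growth: "\<And>x. norm x \<le> \<rho> \<Longrightarrow> norm (P x) \<le> \<epsilon> \<Longrightarrow> norm (V x0) \<le> 2 * norm (V x) \<Longrightarrow> norm x \<le> C * norm (V x)"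
    and x0: "norm x0 \<le> \<rho>" "norm (P x0) \<le> \<epsilon>" "V x0 \<noteq> 0" and q: "norm q \<le> \<epsilon>"
    and \<rho>: "2 * C * norm (V x0) < \<rho>" and C: "C > 0"
    and short: "4 * real CARD('n) * C * norm (q - P x0) < 1"
    and nondeg0: "inj (blinfun_apply (P' x0))"
    and nondeg: "\<And>t x. 0 < t \<Longrightarrow> t \<le> 1 \<Longrightarrow> P x = (1 - t) *\<^sub>R P x0 + t *\<^sub>R q \<Longrightarrow> inj (blinfun_apply (P' x))"
  shows "\<exists>x. P x = q \<and> norm (V x - V x0) \<le> norm (V x0) / 2"
proof -
  define p where "p t = (1 - t) *\<^sub>R P x0 + t *\<^sub>R q" for t
  define v0 where "v0 = norm (V x0)"
  have v0: "v0 > 0" using x0 by (simp add: v0_def)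
  have contP: "continuous_on UNIV P"
    by (intro continuous_at_imp_continuous_on ballI has_derivative_continuous[OF dP])
  have contV: "continuous_on UNIV V"
    by (intro continuous_at_imp_continuous_on ballI has_derivative_continuous[OF dV])
  have contp: "continuous_on UNIV p"
    unfolding p_def by (intro continuous_intros)
  have p_bound: "norm (p t) \<le> \<epsilon>" if "0 \<le> t" "t \<le> 1" for t
  proof -
    have "p t \<in> cball 0 \<epsilon>"
      unfolding p_def using x0(2) q that by (intro convexD[OF convex_cball]) auto
    then show ?thesis by simp
  qed
  \<comment> \<open>The allowed change of \<open>V\<close> grows linearly in time. As the speed of
    \<open>V\<close> along the lift is strictly below \<open>v0 / 2\<close>, the bound can be
    carried past any time before \<open>1\<close>.\<close>
  define K where "K = {(t, x). t \<in> {0..1} \<and> x \<in> cball 0 \<rho> \<and> P x = p t \<and> norm (V x - V x0) \<le> v0 / 2 * t}"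
  have "compact K"
  proof -
    have "K = ({0..1} \<times> cball 0 \<rho>) \<inter>
        ({z. P (snd z) = p (fst z)} \<inter> {z. norm (V (snd z) - V x0) \<le> v0 / 2 * fst z})"
      by (auto simp: K_def)
    moreover have "closed {z. P (snd z) = p (fst z)}"
      by (intro closed_Collect_eq continuous_on_compose2[OF contP] continuous_on_compose2[OF contp]
          continuous_intros) auto
    moreover have "closed {z. norm (V (snd z) - V x0) \<le> v0 / 2 * fst z}"
      by (intro closed_Collect_le continuous_on_compose2[OF contV] continuous_intros) auto
    ultimately show ?thesis
      by (simp add: closed_Int compact_Int_closed compact_Times)
  qed
  moreover have "(0, x0) \<in> K"
    using x0 by (auto simp: K_def p_def)
  ultimately obtain z where z: "z \<in> K" and max: "\<And>z'. z' \<in> K \<Longrightarrow> fst z' \<le> fst z"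
    using continuous_attains_sup[of K fst] by (force intro: continuous_intros)
  \<comment> \<open>If the maximal time is \<open>0\<close>, the point \<open>x0\<close> is chosen,
    where \<open>nondeg0\<close> applies; \<open>nondeg\<close> covers positive times.\<close>
  obtain s x where sx: "(s, x) \<in> K" and sx_nondeg: "inj (blinfun_apply (P' x))"
    and s_max: "\<And>t y. (t, y) \<in> K \<Longrightarrow> t \<le> s"
  proof (cases "fst z = 0")
    case True
    then show ?thesis
      using that[of 0 x0] \<open>(0, x0) \<in> K\<close> nondeg0 max by force
  next
    case False
    then have "inj (blinfun_apply (P' (snd z)))"
      using z by (intro nondeg[of "fst z"]) (auto simp: K_def p_def)
    then show ?thesis
      using that[of "fst z" "snd z"] z max by force
  qed
  have s: "0 \<le> s" "s \<le> 1" "norm x \<le> \<rho>" "P x = p s" "norm (V x - V x0) \<le> v0 / 2 * s"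
    using sx by (auto simp: K_def)
  \<comment> \<open>The size of \<open>V x\<close> thus lies between \<open>v0 / 2\<close> and
    \<open>3 / 2 * v0\<close>, so \<open>growth\<close> applies at \<open>x\<close> and puts it
    strictly inside the ball of radius \<open>\<rho>\<close>.\<close>
  have near: "norm (V x - V x0) \<le> v0 / 2"
    using mult_left_le[of s "v0 / 2"] s v0 by linarith
  then have Vx: "v0 \<le> 2 * norm (V x)" "2 * norm (V x) \<le> 3 * v0"
    using norm_triangle_ineq2[of "V x0" "V x"] norm_triangle_ineq2[of "V x" "V x0"]
    by (auto simp: v0_def norm_minus_commute)
  have "norm x \<le> C * norm (V x)"
    using s p_bound[of s] Vx by (intro growth) (auto simp: v0_def)
  also have "\<dots> \<le> C * (2 * v0)"
    using Vx C v0 by (intro mult_left_mono) auto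
  finally have x_bound: "norm x \<le> 2 * C * v0" by simp
  have "s = 1"
  proof (rule ccontr)
    assume "s \<noteq> 1"
    then have "s < 1" using s by simp
    obtain W g where W: "open W" "p s \<in> W" and g: "g (p s) = x" "continuous_on W g"
      "\<And>y. y \<in> W \<Longrightarrow> P (g y) = y"
      "(g has_derivative inv_into UNIV (blinfun_apply (P' x))) (at (p s))"
      using local_inverse[of P P' x, OF dP contP' sx_nondeg] s by metis
    let ?d = "q - P x0" and ?L = "inv_into UNIV (blinfun_apply (P' x))"
    have "surj (blinfun_apply (P' x))"
      using sx_nondeg by (simp add: bounded_linear.linear blinfun.bounded_linear_right linear_injective_imp_surjective)
    then have L: "P' x (?L y) = y" for y
      by (rule surj_f_inv_f)
    have dp: "(p has_derivative (\<lambda>h. h *\<^sub>R ?d)) (at s)"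
      unfolding p_def by (auto intro!: derivative_eq_intros simp: algebra_simps)
    have "((\<lambda>t. g (p t)) has_derivative (\<lambda>h. ?L (h *\<^sub>R ?d))) (at s)"
      by (rule has_derivative_compose[OF dp g(4)])
    \<comment> \<open>The derivative of \<open>P\<close> cancels against that of its local inverse:
      at time \<open>s\<close> the velocity of \<open>V\<close> along the lift is
      \<open>- cdot x (q - P x0)\<close>.\<close>
    then have "((\<lambda>t. V (g (p t))) has_derivative (\<lambda>h. - cdot (g (p s)) (P' (g (p s)) (?L (h *\<^sub>R ?d))))) (at s)"
      by (rule has_derivative_compose[OF _ dV])
    then have "((\<lambda>t. V (g (p t))) has_vector_derivative (- cdot x ?d)) (at s)"
      unfolding has_vector_derivative_def g(1) L
      by (simp add: cdot_def scaleR_sum_right)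
    then have deriv: "((\<lambda>t. V (g (p t))) has_derivative (\<lambda>h. h *\<^sub>R (- cdot x ?d))) (at s)"
      by (simp add: has_vector_derivative_def)
    have "norm (cdot x ?d) \<le> real CARD('n) * (norm x * norm ?d)"
      by (rule norm_cdot_le)
    also have "\<dots> \<le> real CARD('n) * ((2 * C * v0) * norm ?d)"
      using x_bound by (intro mult_left_mono mult_right_mono) auto
    also have "\<dots> = (4 * real CARD('n) * C * norm ?d) * (v0 / 2)" by simp
    also have "\<dots> < 1 * (v0 / 2)"
      using short v0 by (intro mult_strict_right_mono) auto
    finally have "norm (cdot x ?d) < v0 / 2" by simp
    \<comment> \<open>The gap between this speed and \<open>v0 / 2\<close> is used as the error
      tolerance in the definition of the derivative.\<close>
    then obtain \<delta> where \<delta>: "\<delta> > 0" "\<And>t. norm (t - s) < \<delta> \<Longrightarrow>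
        norm (V (g (p t)) - V (g (p s)) - (t - s) *\<^sub>R (- cdot x ?d)) \<le> (v0 / 2 - norm (cdot x ?d)) * norm (t - s)"
      using deriv unfolding has_derivative_at_alt by (meson diff_gt_0_iff_gt)
    have "eventually (\<lambda>t. norm (V (g (p t)) - V x) \<le> v0 / 2 * (t - s)) (at_right s)"
      unfolding eventually_at_right_field
    proof (intro exI[of _ "s + \<delta>"] conjI allI impI)
      fix t assume t: "s < t" "t < s + \<delta>"
      have "norm (V (g (p t)) - V x) \<le>
          norm (V (g (p t)) - V (g (p s)) - (t - s) *\<^sub>R (- cdot x ?d)) + norm ((t - s) *\<^sub>R (- cdot x ?d))"
        using norm_triangle_ineq[of "V (g (p t)) - V (g (p s)) - (t - s) *\<^sub>R (- cdot x ?d)" "(t - s) *\<^sub>R (- cdot x ?d)"]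
        by (simp only: g(1) diff_add_cancel)
      also have "\<dots> \<le> (v0 / 2 - norm (cdot x ?d)) * (t - s) + (t - s) * norm (cdot x ?d)"
        using \<delta>(2)[of t] t by (intro add_mono) auto
      finally show "norm (V (g (p t)) - V x) \<le> v0 / 2 * (t - s)"
        by (simp add: algebra_simps)
    qed (use \<delta> in auto)
    moreover have "eventually (\<lambda>t. t \<in> {s<..<1}) (at_right s)"
      using \<open>s < 1\<close> by (rule eventually_at_right_real)
    moreover have pW: "eventually (\<lambda>t. p t \<in> W) (at_right s)"
    proof -
      have "(p \<longlongrightarrow> p s) (at_right s)"
        using contp by (metis UNIV_I continuous_on_def tendsto_within_subset subset_UNIV)
      then show ?thesis using W topological_tendstoD by blast
    qed
    moreover have "eventually (\<lambda>t. norm (g (p t)) < \<rho>) (at_right s)"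
    proof -
      have "((\<lambda>t. g (p t)) \<longlongrightarrow> g (p s)) (at s)"
        using has_derivative_continuous[OF has_derivative_compose[OF dp g(4)]] by (simp add: continuous_at)
      then have "((\<lambda>t. norm (g (p t))) \<longlongrightarrow> norm x) (at_right s)"
        unfolding g(1) by (intro tendsto_norm) (auto intro: tendsto_within_subset)
      moreover have "norm x < \<rho>" using x_bound \<rho> by (simp add: v0_def)
      ultimately show ?thesis by (rule order_tendstoD)
    qed
    ultimately have "eventually (\<lambda>t. (t, g (p t)) \<in> K \<and> s < t) (at_right s)"
    proof eventually_elim
      case (elim t)
      have "norm (V (g (p t)) - V x) \<le> v0 / 2 * (t - s)"
        using elim(1) .
      then have "norm (V (g (p t)) - V x0) \<le> v0 / 2 * t"
        using s(5) norm_triangle_ineq[of "V (g (p t)) - V x" "V x - V x0"] by (simp add: algebra_simps)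
      then show ?case
        using elim s(1) g(3) by (auto simp: K_def)
    qed
    then obtain t where "(t, g (p t)) \<in> K" "s < t"
      using eventually_happens trivial_limit_at_right_real by blast
    then show False using s_max by force
  qed
  then show ?thesis
    using s near by (intro exI[of _ x]) (auto simp: p_def v0_def)
qed

section \<open>The Legendre function\<close>

definition hess :: "'n::finite cpoly \<Rightarrow> complex ^ 'n \<Rightarrow> complex ^ 'n ^ 'n" where
  "hess f x = (\<chi> i j. peval (pderiv_wrt j (pderiv_wrt i f)) x)"

definition legendre :: "'n::finite cpoly \<Rightarrow> complex ^ 'n \<Rightarrow> complex" where
  "legendre f x = peval f x - cdot x (grad f x)"

text \<open>Vectors are multiplied componentwise, so this is the gradient of \<open>f\<close> plus
  the diagonal quadratic form with coefficients \<open>a $ i / 2\<close>. The next two definitions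
  give the Legendre function and the Hessian of that sum.\<close>

definition perturbed_grad :: "'n::finite cpoly \<Rightarrow> complex ^ 'n \<Rightarrow> complex ^ 'n \<Rightarrow> complex ^ 'n" where
  "perturbed_grad f a x = grad f x + a * x"

definition perturbed_legendre :: "'n::finite cpoly \<Rightarrow> complex ^ 'n \<Rightarrow> complex ^ 'n \<Rightarrow> complex" where
  "perturbed_legendre f a x = legendre f x - cdot x (a * x) / 2"

definition perturbed_hess :: "'n::finite cpoly \<Rightarrow> complex ^ 'n \<Rightarrow> complex ^ 'n \<Rightarrow> (complex ^ 'n) \<Rightarrow>\<^sub>L (complex ^ 'n)" where
  "perturbed_hess f a x = Blinfun (\<lambda>v. hess f x *v v + a * v)"

lemma has_derivative_cdot [derivative_intros]:
  assumes "(g has_derivative g') (at x within S)" "(h has_derivative h') (at x within S)"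
  shows "((\<lambda>x. cdot (g x) (h x)) has_derivative (\<lambda>v. cdot (g x) (h' v) + cdot (g' v) (h x))) (at x within S)"
proof -
  have "((\<lambda>x. \<Sum>i\<in>UNIV. g x $ i * h x $ i) has_derivative
      (\<lambda>v. \<Sum>i\<in>UNIV. g x $ i * h' v $ i + g' v $ i * h x $ i)) (at x within S)"
    using assms by (intro has_derivative_sum has_derivative_mult
        bounded_linear.has_derivative[OF bounded_linear_vec_nth])
  then show ?thesis by (simp add: cdot_def sum.distrib)
qed

lemma has_derivative_grad: "(grad f has_derivative (\<lambda>v. hess f x *v v)) (at x)"
proof -
  have "((\<lambda>x. \<chi> i. peval (pderiv_wrt i f) x) has_derivative
      (\<lambda>v. \<chi> i. \<Sum>j\<in>UNIV. peval (pderiv_wrt j (pderiv_wrt i f)) x * v $ j)) (at x)"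
    by (intro has_derivative_vec_lambda has_derivative_peval)
  then show ?thesis
    by (simp add: grad_def[abs_def] hess_def matrix_vector_mult_def)
qed

text \<open>The two terms involving the gradient cancel, as for a Legendre transform.\<close>

lemma has_derivative_legendre: "(legendre f has_derivative (\<lambda>v. - cdot x (hess f x *v v))) (at x)"
proof -
  have "((\<lambda>x. peval f x - cdot x (grad f x)) has_derivative
      (\<lambda>v. cdot (grad f x) v - (cdot x (hess f x *v v) + cdot v (grad f x)))) (at x)"
    by (intro has_derivative_diff has_derivative_cdot has_derivative_ident has_derivative_grad)
      (use has_derivative_peval[of f x] in \<open>simp add: cdot_def grad_def\<close>)
  moreover have "cdot (grad f x) v = cdot v (grad f x)" for v
    by (simp add: cdot_def mult.commute)
  ultimately show ?thesis
    by (simp add: legendre_def[abs_def])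
qed

lemma bounded_linear_times_vec: "bounded_linear (\<lambda>v :: complex ^ 'n::finite. a * v)"
  by (simp add: linear_conv_bounded_linear[symmetric] linear_iff vec_eq_iff algebra_simps)

lemma perturbed_hess_apply: "blinfun_apply (perturbed_hess f a x) v = hess f x *v v + a * v"
proof -
  have "bounded_linear (\<lambda>v. hess f x *v v + a * v)"
    by (intro bounded_linear_add matrix_vector_mul_bounded_linear bounded_linear_times_vec)
  then show ?thesis
    by (simp add: perturbed_hess_def bounded_linear_Blinfun_apply)
qed

lemma has_derivative_perturbed_grad:
  "(perturbed_grad f a has_derivative blinfun_apply (perturbed_hess f a x)) (at x)"
  unfolding perturbed_grad_def[abs_def] perturbed_hess_apply[abs_def]
  by (intro has_derivative_add has_derivative_grad bounded_linear_imp_has_derivative bounded_linear_times_vec)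

lemma has_derivative_perturbed_legendre:
  "(perturbed_legendre f a has_derivative (\<lambda>v. - cdot x (perturbed_hess f a x v))) (at x)"
proof -
  have "((\<lambda>x. legendre f x - cdot x (a * x) / 2) has_derivative
      (\<lambda>v. - cdot x (hess f x *v v) - (cdot x (a * v) + cdot v (a * x)) / 2)) (at x)"
    by (intro has_derivative_diff has_derivative_legendre bounded_linear.has_derivative[OF bounded_linear_divide] has_derivative_cdot
        has_derivative_ident bounded_linear_imp_has_derivative bounded_linear_times_vec)
  moreover have "- cdot x (hess f x *v v) - (cdot x (a * v) + cdot v (a * x)) / 2
      = - cdot x (perturbed_hess f a x v)" for v
  proof -
    have "cdot v (a * x) = cdot x (a * v)"
      by (simp add: cdot_def mult_ac)
    moreover have "cdot x (hess f x *v v + a * v) = cdot x (hess f x *v v) + cdot x (a * v)"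
      by (simp add: cdot_def algebra_simps sum.distrib)
    ultimately show ?thesis
      by (simp add: perturbed_hess_apply)
  qed
  ultimately show ?thesis
    by (simp add: perturbed_legendre_def[abs_def])
qed

lemma continuous_on_perturbed_hess: "continuous_on UNIV (perturbed_hess f a)"
proof (rule continuous_on_blinfun_componentwise)
  fix v :: "complex ^ 'a"
  show "continuous_on UNIV (\<lambda>x. blinfun_apply (perturbed_hess f a x) v)"
    unfolding perturbed_hess_apply hess_def matrix_vector_mult_def
    by (simp, intro continuous_intros)
qed

lemma norm_le_sum_norm_nth: "norm x \<le> (\<Sum>i\<in>UNIV. norm (x $ i))"
  by (simp add: norm_vec_def L2_set_le_sum)

lemma norm_times_vec_le: "norm (a * x) \<le> real CARD('n) * (norm a * norm (x :: complex ^ 'n::finite))"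
proof -
  have "norm (a * x) \<le> (\<Sum>i\<in>(UNIV :: 'n set). norm ((a * x) $ i))"
    by (rule norm_le_sum_norm_nth)
  also have "\<dots> \<le> (\<Sum>i\<in>(UNIV :: 'n set). norm a * norm x)"
    by (intro sum_mono) (simp add: norm_mult mult_mono Finite_Cartesian_Product.norm_nth_le)
  finally show ?thesis by simp
qed

section \<open>Degree bounds and the number of nondegenerate solutions\<close>

lemma box_poly_peval:
  assumes "\<And>m i. m \<in> Poly_Mapping.keys f \<Longrightarrow> Poly_Mapping.lookup m i \<le> d"
  shows "box_poly d (peval f)"
  unfolding peval_def[abs_def]
  using assms by (intro box_poly_sum box_poly_cmult box_poly_monomial)

lemma ex_box_poly_peval: "\<exists>d. box_poly d (peval f)"
proof
  show "box_poly (\<Sum>m\<in>Poly_Mapping.keys f. \<Sum>i\<in>UNIV. Poly_Mapping.lookup m i) (peval f)"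
  proof (rule box_poly_peval)
    fix m i assume "m \<in> Poly_Mapping.keys f"
    have "Poly_Mapping.lookup m i \<le> (\<Sum>i\<in>UNIV. Poly_Mapping.lookup m i)"
      by (rule member_le_sum) auto
    also have "\<dots> \<le> (\<Sum>m\<in>Poly_Mapping.keys f. \<Sum>i\<in>UNIV. Poly_Mapping.lookup m i)"
      using \<open>m \<in> _\<close> by (rule member_le_sum) auto
    finally show "Poly_Mapping.lookup m i \<le> (\<Sum>m\<in>Poly_Mapping.keys f. \<Sum>i\<in>UNIV. Poly_Mapping.lookup m i)" .
  qed
qed

text \<open>One \<open>d\<close> serves all \<open>a\<close>, since \<open>a\<close> only enters the
  coefficients of linear and quadratic monomials. Hence the number of solutions can be bounded
  before \<open>a\<close> is chosen.\<close>

lemma box_poly_perturbed: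
  obtains d where "\<And>a i. box_poly d (\<lambda>x. perturbed_grad f a x $ i)" "\<And>a. box_poly d (perturbed_legendre f a)"
proof -
  obtain e where e: "box_poly e (peval f)" using ex_box_poly_peval by blast
  have "\<forall>i. \<exists>d. box_poly d (peval (pderiv_wrt i f))" using ex_box_poly_peval by blast
  then obtain D where D: "\<And>i. box_poly (D i) (peval (pderiv_wrt i f))" by metis
  define d where "d = e + (\<Sum>i\<in>UNIV. D i) + 2"
  have d: "e \<le> d" "1 + D i \<le> d" "1 + 1 \<le> d" for i
    using member_le_sum[of i UNIV D] by (auto simp: d_def)
  have nth: "box_poly d (\<lambda>x. c * x $ i)" for c i
    using d by (intro box_poly_cmult box_poly_mono[OF box_poly_nth]) auto
  have pd: "box_poly d (peval (pderiv_wrt i f))" for i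
    using d(2)[of i] by (intro box_poly_mono[OF D]) auto
  have "box_poly d (\<lambda>x. perturbed_grad f a x $ i)" for a i
    by (simp add: perturbed_grad_def grad_def) (intro box_poly_add pd nth)
  moreover have "box_poly d (perturbed_legendre f a)" for a
  proof -
    have "perturbed_legendre f a = (\<lambda>x. peval f x + (\<Sum>i\<in>UNIV. (-1) * (x $ i * peval (pderiv_wrt i f) x)) +
        (\<Sum>i\<in>UNIV. (- a $ i / 2) * (x $ i * x $ i)))"
      by (rule ext) (simp add: perturbed_legendre_def legendre_def cdot_def grad_def sum_negf sum_divide_distrib mult_ac)
    then show ?thesis
      using d by (simp only:) (intro box_poly_add box_poly_sum box_poly_cmult box_poly_mono[OF e]
          box_poly_mono[OF box_poly_mult[OF box_poly_nth D]] box_poly_mono[OF box_poly_mult[OF box_poly_nth box_poly_nth]])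
  qed
  ultimately show ?thesis using that by blast
qed

text \<open>
  The solutions persist for all \<open>c\<close> near \<open>q\<close>, so that the algebraic relation would have more roots
  than its degree for every such \<open>c\<close>.
\<close>

lemma no_many_nondegenerate_solutions:
  fixes P :: "complex ^ 'n::finite \<Rightarrow> complex ^ 'n" and P' :: "complex ^ 'n \<Rightarrow> ((complex ^ 'n) \<Rightarrow>\<^sub>L (complex ^ 'n))"
    and W :: "complex ^ 'n \<Rightarrow> complex"
  assumes dP: "\<And>x. (P has_derivative blinfun_apply (P' x)) (at x)" and contP': "continuous_on UNIV P'"
    and contW: "continuous_on UNIV W"
    and box: "\<And>i. box_poly d (\<lambda>x. P x $ i)" "box_poly d W"
    and M: "M = (d * (CARD('n) + 1) + 1) ^ CARD('n)"
    and y: "\<And>j. j \<le> M \<Longrightarrow> P (y j) = q" "\<And>j. j \<le> M \<Longrightarrow> inj (blinfun_apply (P' (y j)))"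
    and W: "\<And>i j. i < j \<Longrightarrow> j \<le> M \<Longrightarrow> W (y i) \<noteq> W (y j)"
  shows False
proof -
  have "\<exists>U g. open U \<and> q \<in> U \<and> g q = y j \<and> continuous_on U g \<and> (\<forall>c\<in>U. P (g c) = c)" if "j \<le> M" for j
    using local_inverse[of P P' "y j", OF dP contP' y(2)[OF that]] y(1)[OF that] by metis
  then obtain U g where U: "\<And>j. j \<le> M \<Longrightarrow> open (U j)" "\<And>j. j \<le> M \<Longrightarrow> q \<in> U j"
    and g: "\<And>j. j \<le> M \<Longrightarrow> g j q = y j" "\<And>j. j \<le> M \<Longrightarrow> continuous_on (U j) (g j)"
    "\<And>j c. j \<le> M \<Longrightarrow> c \<in> U j \<Longrightarrow> P (g j c) = c"
    by metis
  have "eventually (\<lambda>c. c \<in> U j) (nhds q)" if "j \<le> M" for j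
    using U that by (simp add: eventually_nhds_in_open)
  then have "eventually (\<lambda>c. \<forall>j\<in>{..M}. c \<in> U j) (nhds q)"
    by (intro eventually_ball_finite) auto
  moreover have "eventually (\<lambda>c. \<forall>i\<in>{..M}. \<forall>j\<in>{..M}. i < j \<longrightarrow> W (g i c) \<noteq> W (g j c)) (nhds q)"
  proof (intro eventually_ball_finite finite_atMost ballI)
    fix i j assume ij: "i \<in> {..M}" "j \<in> {..M}"
    have lim: "((\<lambda>c. W (g k c)) \<longlongrightarrow> W (g k q)) (nhds q)" if "k \<le> M" for k
    proof -
      have "continuous_on (U k) (\<lambda>c. W (g k c))"
        using g(2)[OF that] by (intro continuous_on_compose2[OF contW]) auto
      then show ?thesis
        using U[OF that] by (simp add: continuous_on_eq_continuous_at continuous_at isCont_def tendsto_nhds_iff)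
    qed
    show "eventually (\<lambda>c. i < j \<longrightarrow> W (g i c) \<noteq> W (g j c)) (nhds q)"
    proof (cases "i < j")
      case True
      have "((\<lambda>c. W (g i c) - W (g j c)) \<longlongrightarrow> W (g i q) - W (g j q)) (nhds q)"
        using ij by (intro tendsto_diff lim) auto
      moreover have "W (g i q) - W (g j q) \<noteq> 0"
        using W[OF True] g(1) ij by auto
      ultimately have "eventually (\<lambda>c. W (g i c) - W (g j c) \<noteq> 0) (nhds q)"
        by (rule tendsto_imp_eventually_ne)
      then show ?thesis
        by (rule eventually_mono) simp
    qed simp
  qed
  ultimately have "eventually (\<lambda>c. (\<forall>j\<in>{..M}. c \<in> U j) \<and>
      (\<forall>i\<in>{..M}. \<forall>j\<in>{..M}. i < j \<longrightarrow> W (g i c) \<noteq> W (g j c))) (nhds q)"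
    by (rule eventually_conj)
  then obtain e where e: "e > 0" and near: "\<And>c. dist c q < e \<Longrightarrow>
      (\<forall>j\<in>{..M}. c \<in> U j) \<and> (\<forall>i\<in>{..M}. \<forall>j\<in>{..M}. i < j \<longrightarrow> W (g i c) \<noteq> W (g j c))"
    unfolding eventually_nhds_metric by blast
  obtain Q :: "('n \<Rightarrow> nat) \<Rightarrow> nat \<Rightarrow> complex"
    where Q: "\<exists>\<alpha>\<in>exponent_box M. \<exists>j\<le>M. Q \<alpha> j \<noteq> 0"
    and rel: "\<And>x. (\<Sum>j\<le>M. (\<Sum>\<alpha>\<in>exponent_box M. Q \<alpha> j * (\<Prod>i\<in>UNIV. (P x $ i) ^ \<alpha> i)) * W x ^ j) = 0"
    using algebraic_relation[OF box M] by blast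
  \<comment> \<open>For fixed \<open>c\<close> the relation is a polynomial of degree at most
    \<open>M\<close> in the value of \<open>W\<close>, and the \<open>M + 1\<close> points
    \<open>g k c\<close> over \<open>c\<close> give distinct roots, so all coefficients vanish at
    \<open>c\<close>.\<close>
  have zero: "(\<Sum>\<alpha>\<in>exponent_box M. Q \<alpha> j * (\<Prod>i\<in>UNIV. (c $ i) ^ \<alpha> i)) = 0" if c: "dist c q < e" and j: "j \<le> M" for c j
  proof (rule ccontr)
    define b where "b j = (\<Sum>\<alpha>\<in>exponent_box M. Q \<alpha> j * (\<Prod>i\<in>UNIV. (c $ i) ^ \<alpha> i))" for j
    assume "\<not> ?thesis"
    then have "\<exists>k\<le>M. b k \<noteq> 0" using j by (auto simp: b_def)
    then have fin: "finite {z. (\<Sum>k\<le>M. b k * z ^ k) = 0}" and card: "card {z. (\<Sum>k\<le>M. b k * z ^ k) = 0} \<le> M"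
      using polyfun_rootbound[where c = b and n = M] by blast+
    have "inj_on (\<lambda>k. W (g k c)) {..M}"
      using near[OF c] by (intro linorder_inj_onI) auto
    then have "M < card ((\<lambda>k. W (g k c)) ` {..M})"
      by (simp add: card_image)
    also have "\<dots> \<le> card {z. (\<Sum>k\<le>M. b k * z ^ k) = 0}"
    proof (intro card_mono fin image_subsetI CollectI)
      fix k assume "k \<in> {..M}"
      then have "P (g k c) = c" using near[OF c] g(3) by auto
      then show "(\<Sum>j\<le>M. b j * W (g k c) ^ j) = 0"
        using rel[of "g k c"] by (simp add: b_def)
    qed
    finally show False using card by simp
  qed
  \<comment> \<open>The polydisc about \<open>q\<close> with radii \<open>e / CARD('n)\<close> lies
    in the ball of radius \<open>e\<close>, so the coefficient polynomials vanish on a product of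
    infinite sets.\<close>
  have "Q \<alpha> j = 0" if "\<alpha> \<in> exponent_box M" "j \<le> M" for \<alpha> j
  proof (rule polynomial_vanishing_on_product[where I = UNIV and M = M
        and S = "\<lambda>i. ball (q $ i) (e / CARD('n))" and c = "\<lambda>\<alpha>. Q \<alpha> j"])
    show "infinite (ball (q $ i) (e / CARD('n)))" for i
      using e uncountable_ball[of "e / CARD('n)" "q $ i"] by (auto dest: countable_finite)
    fix x assume x: "\<And>i. i \<in> UNIV \<Longrightarrow> x i \<in> ball (q $ i) (e / CARD('n))"
    have "dist (\<chi> i. x i) q \<le> (\<Sum>i\<in>UNIV. norm (((\<chi> i. x i) - q) $ i))"
      unfolding dist_norm by (rule norm_le_sum_norm_nth)
    also have "\<dots> < (\<Sum>i\<in>(UNIV :: 'n set). e / CARD('n))"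
      using x by (intro sum_strict_mono) (auto simp: dist_norm norm_minus_commute)
    finally have "dist (\<chi> i. x i) q < e" by simp
    from zero[OF this \<open>j \<le> M\<close>]
    show "(\<Sum>m\<in>exponent_box M. Q m j * (\<Prod>i\<in>UNIV. x i ^ m i)) = 0" by simp
  qed (use that in auto)
  then show False using Q by blast
qed


section \<open>Generic choice of the target and the perturbation\<close>

lemma inj_perturbed_hess_iff:
  "inj (blinfun_apply (perturbed_hess f a x)) \<longleftrightarrow> (\<forall>z. hess f x *v z + a * z = 0 \<longrightarrow> z = 0)"
  using linear_injective_0[of "blinfun_apply (perturbed_hess f a x)"]
  by (simp add: bounded_linear.linear blinfun.bounded_linear_right perturbed_hess_apply)

lemma differentiable_hess: "(\<lambda>x. hess f x $ i $ j) differentiable (at x)"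
  unfolding hess_def using has_derivative_peval by (auto simp: differentiable_def)

text \<open>The bad pairs \<open>(q, a)\<close> lie in a finite union of null sets, which cannot
  cover a ball.\<close>

lemma generic_perturbation:
  fixes f :: "'n::finite cpoly" and X :: "nat \<Rightarrow> complex ^ 'n"
  assumes "\<eta> > 0"
  obtains q a where "norm q < \<eta>" "norm a < \<eta>"
    "\<And>j. j \<le> M \<Longrightarrow> inj (blinfun_apply (perturbed_hess f a (X j)))"
    "\<And>j t x. j \<le> M \<Longrightarrow> 0 < t \<Longrightarrow> perturbed_grad f a x = (1 - t) *\<^sub>R perturbed_grad f a (X j) + t *\<^sub>R q \<Longrightarrow>
      inj (blinfun_apply (perturbed_hess f a x))"
proof -
  \<comment> \<open>This is the target \<open>q\<close> for which the segment from
    \<open>perturbed_grad f a (X j)\<close> reaches \<open>perturbed_grad f a x\<close> at time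
    \<open>t\<close>. So \<open>B1 j\<close> collects the pairs whose segment passes through the
    image of a degenerate point.\<close>
  define \<Phi> where "\<Phi> j = (\<lambda>(t, x, a). (1 / t) *\<^sub>R (perturbed_grad f a x - (1 - t) *\<^sub>R perturbed_grad f a (X j)))" for j
  define B1 where "B1 j = {(\<Phi> j (t, x, a), a) | t x a z. t > 0 \<and> z \<noteq> 0 \<and> hess f x *v z + a * z = 0}" for j
  \<comment> \<open>These are the pairs for which \<open>X j\<close> itself is degenerate: the
    Hessian is frozen at \<open>X j\<close>, and the slot of \<open>x\<close> carries an arbitrary
    \<open>q\<close>.\<close>
  define B2 where "B2 j = {(fst (snd (t, x, a)), a) | (t :: real) (x :: complex ^ 'n) a z.
    t > 0 \<and> z \<noteq> 0 \<and> hess f (X j) *v z + a * z = 0}" for j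
  have grad_diff: "(\<lambda>v. perturbed_grad f (snd (snd v)) (fst (snd v))) differentiable (at v)"
    for v :: "real \<times> (complex ^ 'n) \<times> (complex ^ 'n)"
  proof -
    have "((\<lambda>v. perturbed_grad f (snd (snd v)) (fst (snd v))) has_derivative
        (\<lambda>h. hess f (fst (snd v)) *v (fst (snd h)) + (\<chi> i. snd (snd v) $ i * fst (snd h) $ i + snd (snd h) $ i * fst (snd v) $ i))) (at v)"
      unfolding perturbed_grad_def times_vec_def
      by (intro has_derivative_add has_derivative_compose[OF _ has_derivative_grad] has_derivative_vec_lambda
          has_derivative_mult bounded_linear.has_derivative[OF bounded_linear_vec_nth] has_derivative_fst
          has_derivative_snd has_derivative_ident)
    then show ?thesis unfolding differentiable_def by blast
  qed
  have grad_diff': "(\<lambda>v. perturbed_grad f (snd (snd v)) y) differentiable (at v)"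
    for v :: "real \<times> (complex ^ 'n) \<times> (complex ^ 'n)" and y
  proof -
    have "((\<lambda>v. perturbed_grad f (snd (snd v)) y) has_derivative (\<lambda>h. 0 + (\<chi> i. snd (snd h) $ i * y $ i))) (at v)"
      unfolding perturbed_grad_def times_vec_def
      by (intro has_derivative_add has_derivative_const has_derivative_vec_lambda has_derivative_mult_left
          bounded_linear.has_derivative[OF bounded_linear_vec_nth] has_derivative_snd has_derivative_ident)
    then show ?thesis unfolding differentiable_def by blast
  qed
  have "negligible (B1 j)" for j
    unfolding B1_def
  proof (rule negligible_degenerate_perturbations[OF differentiable_hess])
    fix t :: real and x a :: "complex ^ 'n" assume "t > 0"
    have fst: "fst differentiable (at (t, x, a))"
      by (intro bounded_linear_imp_differentiable bounded_linear_fst)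
    have "(\<lambda>v. (1 / fst v) *\<^sub>R (perturbed_grad f (snd (snd v)) (fst (snd v)) -
        (1 - fst v) *\<^sub>R perturbed_grad f (snd (snd v)) (X j))) differentiable (at (t, x, a))"
      using \<open>t > 0\<close> by (intro differentiable_scaleR differentiable_divide differentiable_const fst
          differentiable_diff grad_diff grad_diff') simp
    then show "\<Phi> j differentiable (at (t, x, a))"
      by (simp add: \<Phi>_def case_prod_unfold)
  qed
  moreover have "negligible (B2 j)" for j
    unfolding B2_def
  proof (rule negligible_degenerate_perturbations[where H = "\<lambda>_. hess f (X j)"])
    show "(\<lambda>v. fst (snd v)) differentiable (at (t, x, a))" for t :: real and x a :: "complex ^ 'n"
      by (intro bounded_linear_imp_differentiable bounded_linear_compose[OF bounded_linear_fst bounded_linear_snd])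
  qed simp
  ultimately have "negligible (\<Union>j\<in>{..M}. B1 j \<union> B2 j)"
    by (intro negligible_Union) (auto intro: negligible_Un)
  moreover have "\<not> negligible (ball (0 :: (complex ^ 'n) \<times> (complex ^ 'n)) \<eta>)"
    using assms by (intro open_not_negligible) auto
  ultimately have "\<not> ball 0 \<eta> \<subseteq> (\<Union>j\<in>{..M}. B1 j \<union> B2 j)"
    using negligible_subset by blast
  then obtain q a where qa: "(q, a) \<in> ball 0 \<eta>" and good: "\<And>j. j \<le> M \<Longrightarrow> (q, a) \<notin> B1 j \<and> (q, a) \<notin> B2 j"
    by force
  show ?thesis
  proof
    show "norm q < \<eta>" "norm a < \<eta>"
      using qa norm_fst_le[of q a] norm_snd_le[of a q] by auto
    fix j assume j: "j \<le> M"
    have "(q, a) \<in> B2 j" if "hess f (X j) *v z + a * z = 0" "z \<noteq> 0" for z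
      unfolding B2_def using that by (intro CollectI exI[of _ "1 :: real"] exI[of _ q] exI[of _ a] exI[of _ z]) auto
    then show "inj (blinfun_apply (perturbed_hess f a (X j)))"
      using good[OF j] unfolding inj_perturbed_hess_iff by blast
    fix t :: real and x
    assume t: "0 < t" and x: "perturbed_grad f a x = (1 - t) *\<^sub>R perturbed_grad f a (X j) + t *\<^sub>R q"
    have "q = \<Phi> j (t, x, a)"
      using t by (simp add: \<Phi>_def x)
    then have "(q, a) \<in> B1 j" if "hess f x *v z + a * z = 0" "z \<noteq> 0" for z
      unfolding B1_def using that t by (intro CollectI exI[of _ t] exI[of _ x] exI[of _ a] exI[of _ z]) auto
    then show "inj (blinfun_apply (perturbed_hess f a x))"
      using good[OF j] unfolding inj_perturbed_hess_iff by blast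
  qed
qed

section \<open>Bound for the Legendre function where the gradient is small\<close>

text \<open>Otherwise \<open>M + 1\<close> lifted segments would end over one generic
  \<open>q\<close>, contradicting \<open>no_many_nondegenerate_solutions\<close>. The order of
  choices matters: \<open>M\<close> depends on \<open>f\<close> alone, then come the points, the
  radius, and last the perturbation.\<close>

theorem legendre_bounded:
  fixes f :: "'n::finite cpoly"
  assumes "\<epsilon>0 > 0" and growth0: "\<And>x. norm (grad f x) \<le> \<epsilon>0 \<Longrightarrow> B0 \<le> norm (legendre f x) \<Longrightarrow>
      norm x \<le> C0 * norm (legendre f x)"
  shows "\<exists>\<epsilon>>0. \<exists>L. \<forall>x. norm (grad f x) \<le> \<epsilon> \<longrightarrow> norm (legendre f x) \<le> L"
proof (rule ccontr)
  assume "\<not> ?thesis"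
  then have unbounded: "\<exists>x. norm (grad f x) \<le> \<epsilon> \<and> norm (legendre f x) > L" if "\<epsilon> > 0" for \<epsilon> L
    using that by (meson not_le)
  define B where "B = max B0 1"
  define C where "C = max C0 1"
  let ?n = "real CARD('n)"
  have n: "?n \<ge> 1" by (simp add: Suc_leI)
  have B: "B \<ge> 1" "B \<ge> B0" and C: "C \<ge> 1" "C \<ge> C0" by (auto simp: B_def C_def)
  have growth: "norm x \<le> C * norm (legendre f x)"
    if "norm (grad f x) \<le> \<epsilon>0" "B \<le> norm (legendre f x)" for x
    using growth0[of x] that B C mult_right_mono[of C0 C "norm (legendre f x)"] by fastforce
  obtain d where d: "\<And>a i. box_poly d (\<lambda>x. perturbed_grad f a x $ i)" "\<And>a. box_poly d (perturbed_legendre f a)"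
    using box_poly_perturbed by blast
  define M where "M = (d * (CARD('n) + 1) + 1) ^ CARD('n)"
  \<comment> \<open>The perturbed gradient stays below \<open>2 * \<epsilon>\<close> and differs
    from the gradient by at most \<open>\<epsilon>\<close>, hence \<open>\<epsilon>0 / 3\<close>.
    The other bound makes \<open>4 * ?n * (2 * C) * (3 * \<epsilon>)\<close> at most
    \<open>24 / 32\<close>, as \<open>lift_segment\<close> requires.\<close>
  define \<epsilon> where "\<epsilon> = min (\<epsilon>0 / 3) (1 / (32 * ?n * C))"
  have \<epsilon>: "\<epsilon> > 0" "3 * \<epsilon> \<le> \<epsilon>0" "\<epsilon> \<le> 1 / (32 * ?n * C)"
    using assms(1) n C by (auto simp: \<epsilon>_def)
  \<comment> \<open>Lifting changes the perturbed Legendre function by at most half its initial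
    size, and perturbing changes it by at most \<open>1\<close>. The factor \<open>10\<close> keeps
    the endpoint values apart; \<open>2 * B + 10\<close> keeps the Legendre function above
    \<open>B\<close> in size along the lifts.\<close>
  have "\<exists>X. \<forall>k. (norm (grad f (X k)) \<le> \<epsilon> \<and> norm (legendre f (X k)) > 2 * B + 10) \<and>
      norm (legendre f (X (Suc k))) > 10 * norm (legendre f (X k))"
  proof (rule dependent_nat_choice)
    show "\<exists>x. norm (grad f x) \<le> \<epsilon> \<and> norm (legendre f x) > 2 * B + 10"
      by (rule unbounded[OF \<epsilon>(1)])
    show "\<exists>y. (norm (grad f y) \<le> \<epsilon> \<and> norm (legendre f y) > 2 * B + 10) \<and>
        norm (legendre f y) > 10 * norm (legendre f x)" for x
      using unbounded[OF \<epsilon>(1), of "max (2 * B + 10) (10 * norm (legendre f x))"] by auto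
  qed
  then obtain X where X: "\<And>k. norm (grad f (X k)) \<le> \<epsilon>" "\<And>k. norm (legendre f (X k)) > 2 * B + 10"
    and X_step: "\<And>k. norm (legendre f (X (Suc k))) > 10 * norm (legendre f (X k))"
    by blast
  have X_mono: "10 * norm (legendre f (X i)) \<le> norm (legendre f (X j))" if "i < j" for i j
    using that
  proof (induction j)
    case (Suc j)
    show ?case
    proof (cases "i = j")
      case False
      then have "10 * norm (legendre f (X i)) \<le> norm (legendre f (X j))"
        using Suc by simp
      also have "\<dots> \<le> norm (legendre f (X (Suc j)))"
        using X_step[of j] norm_ge_zero[of "legendre f (X j)"] by linarith
      finally show ?thesis .
    qed (use X_step[of j] in auto)
  qed simp
  \<comment> \<open>The ball contains all starting points and, by the growth estimate with constant
    \<open>2 * C\<close>, all lifts. It is fixed before \<open>a\<close> because the perturbation is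
    small only on a bounded set.\<close>
  define \<rho> where "\<rho> = 1 + (\<Sum>j\<le>M. norm (X j) + 4 * C * (norm (legendre f (X j)) + 1))"
  have \<rho>: "norm (X j) \<le> \<rho>" "4 * C * (norm (legendre f (X j)) + 1) < \<rho>" if "j \<le> M" for j
  proof -
    have "norm (X j) + 4 * C * (norm (legendre f (X j)) + 1) \<le> \<rho> - 1"
      unfolding \<rho>_def using that C
      by (auto intro!: member_le_sum[of j "{..M}" "\<lambda>j. norm (X j) + 4 * C * (norm (legendre f (X j)) + 1)"])
    moreover have "0 \<le> 4 * C * (norm (legendre f (X j)) + 1)"
      using C by auto
    moreover have "0 \<le> norm (X j)" by simp
    ultimately show "norm (X j) \<le> \<rho>" "4 * C * (norm (legendre f (X j)) + 1) < \<rho>" by linarith+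
  qed
  have \<rho>_pos: "\<rho> \<ge> 0" using \<rho>(1)[of 0] norm_ge_zero[of "X 0"] by linarith
  \<comment> \<open>The three summands of the denominator make \<open>\<eta>\<close> and the bound
    for \<open>a * x\<close> on the ball at most \<open>\<epsilon>\<close>, and the bound for
    \<open>cdot x (a * x)\<close> at most \<open>1\<close>.\<close>
  define \<eta> where "\<eta> = min \<epsilon> 1 / (1 + ?n * \<rho> + ?n * \<rho> * (?n * \<rho>))"
  have denom: "1 + ?n * \<rho> + ?n * \<rho> * (?n * \<rho>) \<ge> 1" using \<rho>_pos by simp
  have \<eta>: "\<eta> > 0" "\<eta> \<le> \<epsilon>" "\<eta> * (?n * \<rho>) \<le> \<epsilon>" "\<eta> * (?n * \<rho> * (?n * \<rho>)) \<le> 1"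
  proof -
    let ?D = "1 + ?n * \<rho> + ?n * \<rho> * (?n * \<rho>)"
    show pos: "\<eta> > 0" unfolding \<eta>_def using denom \<epsilon>(1) by (intro divide_pos_pos) auto
    have eq: "\<eta> * ?D = min \<epsilon> 1" unfolding \<eta>_def using denom by auto
    have le: "\<eta> * r \<le> min \<epsilon> 1" if "r \<le> ?D" for r
      using mult_left_mono[OF that, of \<eta>] pos by (simp add: eq)
    have "0 \<le> ?n * \<rho>" "0 \<le> ?n * \<rho> * (?n * \<rho>)" using \<rho>_pos by auto
    then show "\<eta> \<le> \<epsilon>" "\<eta> * (?n * \<rho>) \<le> \<epsilon>" "\<eta> * (?n * \<rho> * (?n * \<rho>)) \<le> 1"
      using le[of 1] le[of "?n * \<rho>"] le[of "?n * \<rho> * (?n * \<rho>)"] by auto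
  qed
  obtain q a where q: "norm q < \<eta>" and a: "norm a < \<eta>"
    and inj0: "\<And>j. j \<le> M \<Longrightarrow> inj (blinfun_apply (perturbed_hess f a (X j)))"
    and inj: "\<And>j t x. j \<le> M \<Longrightarrow> 0 < t \<Longrightarrow>
      perturbed_grad f a x = (1 - t) *\<^sub>R perturbed_grad f a (X j) + t *\<^sub>R q \<Longrightarrow>
      inj (blinfun_apply (perturbed_hess f a x))"
    using generic_perturbation[OF \<eta>(1), of M f X] by blast
  let ?P = "perturbed_grad f a" and ?V = "perturbed_legendre f a"
  have ax: "norm (a * x) \<le> \<eta> * (?n * \<rho>)" if "norm x \<le> \<rho>" for x
  proof -
    have "norm (a * x) \<le> ?n * (norm a * norm x)" by (rule norm_times_vec_le)
    also have "\<dots> \<le> ?n * (\<eta> * \<rho>)"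
      using a that \<eta>(1) by (intro mult_left_mono mult_mono) auto
    finally show ?thesis by (simp add: mult_ac)
  qed
  have P_close: "norm (?P x - grad f x) \<le> \<epsilon>" if "norm x \<le> \<rho>" for x
    using ax[OF that] \<eta>(3) by (simp add: perturbed_grad_def)
  have V_close: "norm (?V x - legendre f x) \<le> 1" if "norm x \<le> \<rho>" for x
  proof -
    have "norm (cdot x (a * x)) \<le> ?n * (norm x * norm (a * x))" by (rule norm_cdot_le)
    also have "\<dots> \<le> ?n * (\<rho> * (\<eta> * (?n * \<rho>)))"
      using ax[OF that] that \<rho>_pos by (intro mult_left_mono mult_mono) auto
    also have "\<dots> \<le> 1" using \<eta>(4) by (simp add: mult_ac)
    finally show ?thesis by (simp add: perturbed_legendre_def norm_divide)
  qed
  have V_bounds: "norm (?V x) \<le> norm (legendre f x) + 1" "norm (legendre f x) \<le> norm (?V x) + 1"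
    if "norm x \<le> \<rho>" for x
    using V_close[OF that] norm_triangle_ineq2[of "?V x" "legendre f x"]
      norm_triangle_ineq2[of "legendre f x" "?V x"] by (auto simp: norm_minus_commute)
  have endpoint: "\<exists>y. ?P y = q \<and> norm (?V y - ?V (X j)) \<le> norm (?V (X j)) / 2" if j: "j \<le> M" for j
  proof (rule lift_segment[where \<rho> = \<rho> and \<epsilon> = "2 * \<epsilon>" and C = "2 * C"])
    show "(?P has_derivative blinfun_apply (perturbed_hess f a x)) (at x)" for x
      by (rule has_derivative_perturbed_grad)
    show "(?V has_derivative (\<lambda>v. - cdot x (perturbed_hess f a x v))) (at x)" for x
      by (rule has_derivative_perturbed_legendre)
    show "continuous_on UNIV (perturbed_hess f a)"
      by (rule continuous_on_perturbed_hess)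
    have Vj: "norm (?V (X j)) > 2 * B + 9"
      using V_bounds(2)[OF \<rho>(1)[OF j]] X(2)[of j] by linarith
    then show "?V (X j) \<noteq> 0" using B by auto
    show "norm (X j) \<le> \<rho>" using \<rho>(1)[OF j] .
    show Pj: "norm (?P (X j)) \<le> 2 * \<epsilon>"
      using P_close[OF \<rho>(1)[OF j]] X(1)[of j] norm_triangle_sub[of "?P (X j)" "grad f (X j)"] by linarith
    show "norm q \<le> 2 * \<epsilon>" using q \<eta>(2) \<epsilon>(1) by linarith
    show "2 * C > 0" using C by simp
    have "2 * (2 * C) * norm (?V (X j)) \<le> 4 * C * (norm (legendre f (X j)) + 1)"
      using V_bounds(1)[OF \<rho>(1)[OF j]] C by simp
    then show "2 * (2 * C) * norm (?V (X j)) < \<rho>"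
      using \<rho>(2)[OF j] by linarith
    have "norm (q - ?P (X j)) \<le> 3 * \<epsilon>"
      using norm_triangle_ineq4[of q "?P (X j)"] Pj q \<eta>(2) by linarith
    then have "4 * ?n * (2 * C) * norm (q - ?P (X j)) \<le> 4 * ?n * (2 * C) * (3 * (1 / (32 * ?n * C)))"
      using \<epsilon>(3) C n by (intro mult_left_mono) auto
    also have "\<dots> < 1" using C n by (simp add: field_simps)
    finally show "4 * ?n * (2 * C) * norm (q - ?P (X j)) < 1" .
    show "inj (blinfun_apply (perturbed_hess f a (X j)))" by (rule inj0[OF j])
    show "inj (blinfun_apply (perturbed_hess f a x))"
      if "0 < t" "t \<le> 1" "?P x = (1 - t) *\<^sub>R ?P (X j) + t *\<^sub>R q" for t x
      using inj[OF j] that by blast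
    \<comment> \<open>The size of \<open>?V x\<close> exceeds \<open>1\<close> here, so the
      perturbation error \<open>1\<close> at most doubles the growth constant.\<close>
    fix x assume x: "norm x \<le> \<rho>" "norm (?P x) \<le> 2 * \<epsilon>" "norm (?V (X j)) \<le> 2 * norm (?V x)"
    have "norm (grad f x) \<le> \<epsilon>0"
      using P_close[OF x(1)] x(2) \<epsilon>(2) norm_triangle_sub[of "grad f x" "?P x"]
      by (simp add: norm_minus_commute)
    moreover have "B \<le> norm (legendre f x)"
      using V_bounds(1)[OF x(1)] x(3) Vj by linarith
    ultimately have "norm x \<le> C * norm (legendre f x)" by (rule growth)
    also have "\<dots> \<le> C * (2 * norm (?V x))"
      using V_bounds(2)[OF x(1)] x(3) Vj B C by (intro mult_left_mono) linarith+
    finally show "norm x \<le> 2 * C * norm (?V x)" by simp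
  qed
  then obtain y where y: "\<And>j. j \<le> M \<Longrightarrow> ?P (y j) = q"
    "\<And>j. j \<le> M \<Longrightarrow> norm (?V (y j) - ?V (X j)) \<le> norm (?V (X j)) / 2"
    by metis
  show False
  proof (rule no_many_nondegenerate_solutions[OF has_derivative_perturbed_grad continuous_on_perturbed_hess _ d M_def])
    show "continuous_on UNIV ?V"
      by (intro continuous_at_imp_continuous_on ballI has_derivative_continuous[OF has_derivative_perturbed_legendre])
    show "?P (y j) = q" if "j \<le> M" for j using y(1)[OF that] .
    show "inj (blinfun_apply (perturbed_hess f a (y j)))" if "j \<le> M" for j
      using inj[OF that, of 1 "y j"] y(1)[OF that] by simp
    \<comment> \<open>With \<open>L\<close> the norm of \<open>legendre f (X i)\<close>, the value
      at \<open>y i\<close> has size at most \<open>3 / 2 * (L + 1)\<close> and the one at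
      \<open>y j\<close> at least \<open>(10 * L - 1) / 2\<close>, which is larger as
      \<open>L > 10\<close>.\<close>
    show "?V (y i) \<noteq> ?V (y j)" if "i < j" "j \<le> M" for i j
    proof
      assume "?V (y i) = ?V (y j)"
      then have "norm (?V (y i)) = norm (?V (y j))" by simp
      moreover have "norm (?V (y i)) \<le> 3 / 2 * norm (?V (X i))"
        using y(2)[of i] that norm_triangle_sub[of "?V (y i)" "?V (X i)"] by linarith
      moreover have "norm (?V (X j)) / 2 \<le> norm (?V (y j))"
        using y(2)[of j] that norm_triangle_ineq2[of "?V (X j)" "?V (y j)"] by (simp add: norm_minus_commute)
      ultimately show False
        using X_mono[OF that(1)] X(2)[of i] B V_bounds(1)[OF \<rho>(1)[of i]] V_bounds(2)[OF \<rho>(1)[of j]] that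
        by (simp add: less_imp_le_nat)
    qed
  qed
qed

section \<open>Growth at infinity\<close>

text \<open>The unit sphere of the weighted radius, the maximum of the \<open>w i\<close>-th roots
  of \<open>norm (y $ i)\<close>. It is also the unit sphere of the maximum norm, hence the same for
  all weights.\<close>

definition wsphere :: "(complex ^ 'n::finite) set" where
  "wsphere = {y. (\<forall>i. norm (y $ i) \<le> 1) \<and> (\<exists>i. norm (y $ i) = 1)}"

lemma compact_wsphere: "compact (wsphere :: (complex ^ 'n::finite) set)"
proof -
  have "(wsphere :: (complex ^ 'n) set) \<subseteq> cball 0 (real CARD('n))"
  proof
    fix y :: "complex ^ 'n" assume "y \<in> wsphere"
    then have "(\<Sum>i\<in>UNIV. norm (y $ i)) \<le> (\<Sum>i\<in>(UNIV :: 'n set). 1)"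
      by (intro sum_mono) (simp add: wsphere_def)
    then show "y \<in> cball 0 (real CARD('n))"
      using norm_le_sum_norm_nth[of y] by simp
  qed
  moreover have "closed (wsphere :: (complex ^ 'n) set)"
  proof -
    have *: "(wsphere :: (complex ^ 'n) set) = (\<Inter>i. {y. norm (y $ i) \<le> 1}) \<inter> (\<Union>i. {y. norm (y $ i) = 1})"
      by (auto simp: wsphere_def)
    show ?thesis
      unfolding * by (intro closed_Int closed_INT closed_UN ballI finite_class.finite_UNIV
          closed_Collect_le closed_Collect_eq continuous_intros)
  qed
  ultimately show ?thesis
    by (meson bounded_cball bounded_subset compact_eq_bounded_closed)
qed

text \<open>Weighted polar coordinates: \<open>R\<close> is the largest of the \<open>w i\<close>-th
  roots of \<open>norm (x $ i)\<close>.\<close>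

lemma wsphere_decomposition:
  fixes x :: "complex ^ 'n::finite"
  assumes "x \<noteq> 0" and w: "\<And>i. 0 < w i"
  obtains R y where "R > 0" "y \<in> wsphere" "x = wscale w (complex_of_real R) y"
proof -
  define r where "r i = root (w i) (norm (x $ i))" for i
  define R where "R = Max (range r)"
  have r: "r i ^ w i = norm (x $ i)" "r i \<ge> 0" for i
    using w by (simp_all add: r_def)
  have le: "r i \<le> R" for i by (simp add: R_def)
  obtain k where "x $ k \<noteq> 0" using assms(1) by (auto simp: vec_eq_iff)
  then have "r k > 0" using w by (simp add: r_def)
  then have R: "R > 0" using le[of k] by linarith
  have "R \<in> range r" unfolding R_def by (rule Max_in) auto
  then obtain l where l: "R = r l" by blast
  define y where "y = (\<chi> i. x $ i / complex_of_real R ^ w i)"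
  have y: "norm (y $ i) = r i ^ w i / R ^ w i" for i
    using R by (simp add: y_def norm_divide norm_power r)
  show ?thesis
  proof
    show "R > 0" by fact
    show "x = wscale w (complex_of_real R) y"
      using R by (simp add: vec_eq_iff wscale_def y_def)
    have "norm (y $ i) \<le> 1" for i
      unfolding y using R le[of i] r(2)[of i] by (simp add: power_mono)
    moreover have "norm (y $ l) = 1"
      unfolding y using R by (simp flip: l)
    ultimately show "y \<in> wsphere" by (auto simp: wsphere_def)
  qed
qed

text \<open>Raising the exponent from \<open>w i\<close> to \<open>e\<close> requires a base of at
  least \<open>1\<close>; the separate bound \<open>S\<close> covers the points with
  \<open>R < 1\<close>.\<close>

lemma norm_wscale_nth_le:
  assumes "y \<in> wsphere" "0 \<le> R" "R \<le> S" "1 \<le> S" "w i \<le> e"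
  shows "norm (wscale w (complex_of_real R) y $ i) \<le> S ^ e"
proof -
  have "norm (wscale w (complex_of_real R) y $ i) = R ^ w i * norm (y $ i)"
    using assms by (simp add: wscale_def norm_mult norm_power)
  also have "\<dots> \<le> S ^ w i * 1"
    using assms by (intro mult_mono power_mono) (auto simp: wsphere_def)
  also have "\<dots> \<le> S ^ e" using assms by (simp add: power_increasing)
  finally show ?thesis .
qed

lemma norm_wscale_le:
  fixes y :: "complex ^ 'n::finite"
  assumes "y \<in> wsphere" "0 \<le> R" "R \<le> S" "1 \<le> S" "\<And>i. w i \<le> e"
  shows "norm (wscale w (complex_of_real R) y) \<le> real CARD('n) * S ^ e"
proof -
  have "(\<Sum>i\<in>UNIV. norm (wscale w (complex_of_real R) y $ i)) \<le> (\<Sum>i\<in>(UNIV :: 'n set). S ^ e)"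
    using assms by (intro sum_mono norm_wscale_nth_le)
  then show ?thesis
    using norm_le_sum_norm_nth[of "wscale w (complex_of_real R) y"] by simp
qed

lemma tendsto_power_ratio:
  assumes "filterlim R at_top sequentially" "d \<le> e"
  shows "(\<lambda>j. complex_of_real (R j ^ d / R j ^ e)) \<longlonglongrightarrow> (if d = e then 1 else 0)"
proof -
  have pos: "eventually (\<lambda>j. R j > 0) sequentially"
    using assms(1) by (simp add: filterlim_at_top_dense)
  show ?thesis
  proof (cases "d = e")
    case True
    have "eventually (\<lambda>j. complex_of_real (R j ^ d / R j ^ e) = 1) sequentially"
      using pos by eventually_elim (simp add: True)
    then show ?thesis
      using True by (simp add: tendsto_eventually)
  next
    case False
    then have "e - d > 0" using assms(2) by simp
    then have "filterlim (\<lambda>j. R j ^ (e - d)) at_top sequentially"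
      by (rule filterlim_pow_at_top[OF _ assms(1)])
    then have "(\<lambda>j. inverse (R j ^ (e - d))) \<longlonglongrightarrow> 0"
      by (rule tendsto_inverse_0_at_top)
    moreover have "eventually (\<lambda>j. inverse (R j ^ (e - d)) = R j ^ d / R j ^ e) sequentially"
      using pos by eventually_elim (use assms(2) in \<open>simp add: power_diff field_simps\<close>)
    ultimately have "(\<lambda>j. R j ^ d / R j ^ e) \<longlonglongrightarrow> 0"
      by (rule Lim_transform_eventually)
    then have "(\<lambda>j. complex_of_real (R j ^ d / R j ^ e)) \<longlonglongrightarrow> of_real 0"
      by (rule tendsto_of_real)
    then show ?thesis using False by simp
  qed
qed

section \<open>Expansion of a polynomial and its gradient along weighted rays\<close>

context
  fixes w :: "'n::finite \<Rightarrow> nat" and N :: nat and f :: "'n cpoly"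
  assumes deg: "\<And>d. d > N \<Longrightarrow> wpart w d f = 0"
begin

lemma f_eq_sum_wpart: "f = (\<Sum>d\<le>N. wpart w d f)"
proof (rule sum_wpart[symmetric])
  fix m assume "m \<in> Poly_Mapping.keys f"
  then have "m \<in> Poly_Mapping.keys (wpart w (wdeg w m) f)"
    by (simp add: keys_wpart)
  then show "wdeg w m \<le> N"
    using deg[of "wdeg w m"] by (metis keys_zero empty_iff not_le)
qed

lemma peval_eq_sum_wpart: "peval f x = (\<Sum>d\<le>N. peval (wpart w d f) x)"
  by (subst f_eq_sum_wpart) (rule peval_sum)

lemma grad_eq_sum_wpart: "grad f x $ i = (\<Sum>d\<le>N. grad (wpart w d f) x $ i)"
  by (subst f_eq_sum_wpart) (simp add: grad_def pderiv_wrt_sum peval_sum)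

lemma peval_wscale: "peval f (wscale w r y) = (\<Sum>d\<le>N. r ^ d * peval (wpart w d f) y)"
  by (simp add: peval_eq_sum_wpart peval_wpart_wscale)

lemma grad_wscale: "r ^ w i * grad f (wscale w r y) $ i = (\<Sum>d\<le>N. r ^ d * grad (wpart w d f) y $ i)"
  unfolding grad_eq_sum_wpart sum_distrib_left by (simp add: grad_def peval_pderiv_wpart_wscale)

lemma euler_wscale:
  "(\<Sum>i\<in>UNIV. of_nat (w i) * (wscale w r y $ i * grad f (wscale w r y) $ i))
    = (\<Sum>d\<le>N. of_nat d * (r ^ d * peval (wpart w d f) y))"
proof -
  let ?x = "wscale w r y"
  have "(\<Sum>i\<in>UNIV. of_nat (w i) * (?x $ i * grad f ?x $ i))
    = (\<Sum>d\<le>N. \<Sum>i\<in>UNIV. of_nat (w i) * (?x $ i * grad (wpart w d f) ?x $ i))"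
    unfolding grad_eq_sum_wpart sum_distrib_left by (rule sum.swap)
  also have "\<dots> = (\<Sum>d\<le>N. of_nat d * peval (wpart w d f) ?x)"
    unfolding grad_def vec_lambda_beta euler_wpart ..
  finally show ?thesis by (simp add: peval_wpart_wscale)
qed

text \<open>Euler's formula eliminates the leading part from the Legendre function.\<close>

lemma legendre_wscale:
  "of_nat N * legendre f (wscale w r y)
     + (\<Sum>i\<in>UNIV. (of_nat N - of_nat (w i)) * (wscale w r y $ i * grad f (wscale w r y) $ i))
   = (\<Sum>d\<le>N. (of_nat N - of_nat d) * (r ^ d * peval (wpart w d f) y))"
  unfolding legendre_def cdot_def left_diff_distrib sum_subtractf euler_wscale right_diff_distrib
    peval_wscale sum_distrib_left[symmetric]
  by simp

end

text \<open>Compactness: along counterexamples with \<open>R\<close> tending to infinity the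
  directions accumulate at some \<open>b\<close> in \<open>wsphere\<close>. The dominant terms force
  \<open>\<partial>f\<^sub>N\<close> and \<open>f\<^sub>N\<^sub>-\<^sub>k\<close> to vanish at
  \<open>b\<close>, so \<open>b = 0\<close>, which is impossible. The single \<open>m\<close> bounds
  radius, gradient and growth at once, so that the negation yields one sequence.\<close>

lemma legendre_growth_on_rays:
  fixes f :: "'n::finite cpoly"
  assumes wly: "wly_at_infinity w N k f" and large: "\<And>i. w i \<le> N - k"
  shows "\<exists>m. \<forall>R y. R \<ge> real (Suc m) \<longrightarrow> y \<in> wsphere \<longrightarrow>
    norm (grad f (wscale w (complex_of_real R) y)) \<le> 1 / real (Suc m) \<longrightarrow>
    R ^ (N - k) / real (Suc m) \<le> norm (legendre f (wscale w (complex_of_real R) y))"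
proof (rule ccontr)
  assume "\<not> ?thesis"
  then have "\<forall>m. \<exists>R y. R \<ge> real (Suc m) \<and> y \<in> wsphere \<and>
      norm (grad f (wscale w (complex_of_real R) y)) \<le> 1 / real (Suc m) \<and>
      norm (legendre f (wscale w (complex_of_real R) y)) < R ^ (N - k) / real (Suc m)"
    by (meson not_le)
  then obtain R0 y0 where "\<forall>m. R0 m \<ge> real (Suc m) \<and> y0 m \<in> wsphere \<and>
      norm (grad f (wscale w (complex_of_real (R0 m)) (y0 m))) \<le> 1 / real (Suc m) \<and>
      norm (legendre f (wscale w (complex_of_real (R0 m)) (y0 m))) < R0 m ^ (N - k) / real (Suc m)"
    by metis
  then have R0: "\<And>m. R0 m \<ge> real (Suc m)" and y0: "\<And>m. y0 m \<in> wsphere"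
    and grad0: "\<And>m. norm (grad f (wscale w (complex_of_real (R0 m)) (y0 m))) \<le> 1 / real (Suc m)"
    and leg0: "\<And>m. norm (legendre f (wscale w (complex_of_real (R0 m)) (y0 m))) < R0 m ^ (N - k) / real (Suc m)"
    by blast+
  obtain b s where b: "b \<in> wsphere" and s: "strict_mono s" and lim: "(y0 \<circ> s) \<longlonglongrightarrow> b"
    using compact_wsphere y0 unfolding compact_def by metis
  define R y where "R j = R0 (s j)" and "y j = y0 (s j)" for j
  define x where "x j = wscale w (complex_of_real (R j)) (y j)" for j
  define \<delta> where "\<delta> j = 1 / real (Suc (s j))" for j
  have R_large: "R j \<ge> real (Suc j)" for j
    unfolding R_def using R0[of "s j"] seq_suble[OF s, of j] by linarith
  then have R1: "R j \<ge> 1" for j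
    using order_trans[of 1 "real (Suc j)" "R j"] by simp
  have \<delta>: "\<delta> \<longlonglongrightarrow> 0"
    unfolding \<delta>_def using LIMSEQ_subseq_LIMSEQ[OF LIMSEQ_inverse_real_of_nat s]
    by (simp add: o_def inverse_eq_divide)
  have y: "y j \<in> wsphere" and x_grad: "norm (grad f (x j)) \<le> \<delta> j"
    and x_leg: "norm (legendre f (x j)) \<le> R j ^ (N - k) * \<delta> j" for j
    using y0 grad0[of "s j"] leg0[of "s j"] by (auto simp: x_def R_def y_def \<delta>_def)
  have y_lim: "y \<longlonglongrightarrow> b" using lim by (simp add: y_def[abs_def] o_def)
  have R_lim: "filterlim R at_top sequentially"
  proof (rule filterlim_at_top_mono)
    show "filterlim (\<lambda>j. real (Suc j)) at_top sequentially"
      by (rule filterlim_compose[OF filterlim_real_sequentially filterlim_Suc])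
    show "eventually (\<lambda>j. real (Suc j) \<le> R j) sequentially" using R_large by simp
  qed
  have x_grad_nth: "norm (grad f (x j) $ i) \<le> \<delta> j" for i j
    using x_grad[of j] Finite_Cartesian_Product.norm_nth_le[of "grad f (x j)" i] by linarith
  have kN: "0 < k" "k < N" and w_pos: "\<And>i. 0 < w i"
    using wly by (auto simp: wly_at_infinity_def weight_vector_def)
  have deg: "\<And>d. d > N \<Longrightarrow> wpart w d f = 0" and gap: "\<And>d. N - k < d \<Longrightarrow> d < N \<Longrightarrow> wpart w d f = 0"
    using wly by (auto simp: wly_at_infinity_def)
  have w_le: "w i \<le> N" for i using large[of i] by simp
  have peval_lim: "(\<lambda>j. peval g (y j)) \<longlonglongrightarrow> peval g b" for g
    using continuous_on_peval[OF continuous_on_id, of UNIV g] y_lim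
    by (simp add: continuous_on_eq_continuous_at continuous_at isCont_tendsto_compose)
  \<comment> \<open>Dividing \<open>grad_wscale\<close> by \<open>R j ^ N\<close> isolates degree
    \<open>N\<close> in the limit; the gradient side tends to \<open>0\<close> because
    \<open>w i \<le> N\<close>.\<close>
  have grad_zero: "grad (wpart w N f) b = 0"
  proof -
    have "grad (wpart w N f) b $ i = 0" for i
    proof (rule LIMSEQ_unique)
      have eq: "(\<Sum>d\<le>N. complex_of_real (R j ^ d / R j ^ N) * grad (wpart w d f) (y j) $ i)
          = complex_of_real (R j ^ w i / R j ^ N) * grad f (x j) $ i" for j
        using grad_wscale[OF deg, where r = "complex_of_real (R j)" and i = i and y = "y j"]
        by (simp add: x_def sum_divide_distrib[symmetric])
      have "(\<lambda>j. \<Sum>d\<le>N. complex_of_real (R j ^ d / R j ^ N) * grad (wpart w d f) (y j) $ i)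
          \<longlonglongrightarrow> (\<Sum>d\<le>N. (if d = N then 1 else 0) * grad (wpart w d f) b $ i)"
        unfolding grad_def vec_lambda_beta
        by (intro tendsto_sum tendsto_mult tendsto_power_ratio R_lim peval_lim) auto
      then show "(\<lambda>j. complex_of_real (R j ^ w i / R j ^ N) * grad f (x j) $ i) \<longlonglongrightarrow> grad (wpart w N f) b $ i"
        unfolding eq by (simp add: if_distrib[of "\<lambda>c. c * _"] sum.delta cong: if_cong)
      show "(\<lambda>j. complex_of_real (R j ^ w i / R j ^ N) * grad f (x j) $ i) \<longlonglongrightarrow> 0"
      proof (rule Lim_null_comparison[OF _ \<delta>], intro always_eventually allI)
        fix j
        have "R j ^ w i / R j ^ N \<le> 1"
          using R1[of j] w_le[of i] by (simp add: power_increasing)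
        then show "norm (complex_of_real (R j ^ w i / R j ^ N) * grad f (x j) $ i) \<le> \<delta> j"
          using x_grad_nth[of j i] R1[of j] mult_mono[of "R j ^ w i / R j ^ N" 1 "norm (grad f (x j) $ i)" "\<delta> j"]
          by (simp add: norm_mult norm_divide norm_power)
      qed
    qed
    then show ?thesis by (simp add: vec_eq_iff)
  qed
  \<comment> \<open>Divide \<open>legendre_wscale\<close> by \<open>R j ^ (N - k)\<close>: degree
    \<open>N\<close> has the factor \<open>0\<close>, the degrees between are absent and the lower
    ones tend to \<open>0\<close>, so degree \<open>N - k\<close> remains with the factor
    \<open>k\<close>.\<close>
  have "of_nat k * peval (wpart w (N - k) f) b = 0"
  proof (rule LIMSEQ_unique)
    define T where "T j = (\<Sum>d\<le>N. (of_nat N - of_nat d) *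
        (complex_of_real (R j ^ d / R j ^ (N - k)) * peval (wpart w d f) (y j)))" for j
    have T_eq: "T j = (of_nat N * legendre f (x j)
        + (\<Sum>i\<in>UNIV. (of_nat N - of_nat (w i)) * (x j $ i * grad f (x j) $ i))) / complex_of_real (R j ^ (N - k))" for j
    proof -
      have "T j = (\<Sum>d\<le>N. (of_nat N - of_nat d) *
          (complex_of_real (R j) ^ d * peval (wpart w d f) (y j))) / complex_of_real (R j ^ (N - k))"
        unfolding T_def sum_divide_distrib by simp
      then show ?thesis
        unfolding x_def by (simp only: legendre_wscale[OF deg])
    qed
    have "(\<lambda>j. (of_nat N - of_nat d) * (complex_of_real (R j ^ d / R j ^ (N - k)) * peval (wpart w d f) (y j)))
        \<longlonglongrightarrow> (if d = N - k then of_nat k * peval (wpart w (N - k) f) b else 0)" if "d \<le> N" for d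
    proof -
      consider "d = N" | "N - k < d" "d < N" | "d \<le> N - k" using \<open>d \<le> N\<close> by linarith
      then show ?thesis
      proof cases
        case 1
        then have "d \<noteq> N - k" using kN by simp
        then show ?thesis using 1 by simp
      next
        case 2
        then show ?thesis by (simp add: gap)
      next
        case 3
        have "(\<lambda>j. (of_nat N - of_nat d) * (complex_of_real (R j ^ d / R j ^ (N - k)) * peval (wpart w d f) (y j)))
          \<longlonglongrightarrow> (of_nat N - of_nat d) * ((if d = N - k then 1 else 0) * peval (wpart w d f) b)"
          by (intro tendsto_mult tendsto_const tendsto_power_ratio R_lim peval_lim 3)
        moreover have "of_nat N - of_nat (N - k) = (of_nat k :: complex)"
          using kN by (simp add: of_nat_diff)
        ultimately show ?thesis by (cases "d = N - k") simp_all
      qed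
    qed
    then have "T \<longlonglongrightarrow> (\<Sum>d\<le>N. if d = N - k then of_nat k * peval (wpart w (N - k) f) b else 0)"
      unfolding T_def[abs_def] by (intro tendsto_sum) auto
    then show "T \<longlonglongrightarrow> of_nat k * peval (wpart w (N - k) f) b" by simp
    \<comment> \<open>Both terms on the left of \<open>legendre_wscale\<close> are of order
      \<open>R j ^ (N - k) * \<delta> j\<close>: the Legendre term by the choice of the sequence,
      the gradient terms because \<open>w i \<le> N - k\<close> bounds the coordinates of
      \<open>x j\<close>.\<close>
    have "(\<lambda>j. (real N + (\<Sum>i\<in>(UNIV :: 'n set). real N)) * \<delta> j) \<longlonglongrightarrow> 0"
      using tendsto_mult_right_zero[OF \<delta>] .
    then show "T \<longlonglongrightarrow> 0"
    proof (rule Lim_null_comparison[rotated], intro always_eventually allI)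
      fix j
      let ?r = "R j ^ (N - k)"
      have r: "?r > 0" using R1[of j] by simp
      have \<delta>_nonneg: "0 \<le> \<delta> j" by (simp add: \<delta>_def)
      have "norm ((of_nat N - of_nat (w i)) * (x j $ i * grad f (x j) $ i)) \<le> real N * (?r * \<delta> j)" for i
      proof -
        have "norm (of_nat N - of_nat (w i) :: complex) = real (N - w i)"
          using w_le[of i] by (metis of_nat_diff norm_of_nat)
        then have "norm (of_nat N - of_nat (w i) :: complex) \<le> real N" by simp
        moreover have "norm (x j $ i) \<le> ?r"
          unfolding x_def using y[of j] R1[of j] large[of i] by (intro norm_wscale_nth_le) auto
        ultimately show ?thesis
          unfolding norm_mult using x_grad_nth[of j i] r by (intro mult_mono) auto
      qed
      then have "norm (\<Sum>i\<in>UNIV. (of_nat N - of_nat (w i)) * (x j $ i * grad f (x j) $ i))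
          \<le> (\<Sum>i\<in>(UNIV :: 'n set). real N * (?r * \<delta> j))"
        by (intro sum_norm_le) auto
      moreover have "norm (of_nat N * legendre f (x j)) \<le> real N * (?r * \<delta> j)"
        using x_leg[of j] by (simp add: norm_mult mult_left_mono)
      ultimately have "norm (of_nat N * legendre f (x j)
          + (\<Sum>i\<in>UNIV. (of_nat N - of_nat (w i)) * (x j $ i * grad f (x j) $ i)))
          \<le> real N * (?r * \<delta> j) + (\<Sum>i\<in>(UNIV :: 'n set). real N * (?r * \<delta> j))"
        by (intro norm_triangle_le add_mono)
      also have "\<dots> = (real N + (\<Sum>i\<in>(UNIV :: 'n set). real N)) * \<delta> j * ?r"
        by (simp add: algebra_simps)
      finally show "norm (T j) \<le> (real N + (\<Sum>i\<in>(UNIV :: 'n set). real N)) * \<delta> j"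
        unfolding T_eq norm_divide norm_of_real using r by (simp add: pos_divide_le_eq)
    qed
  qed
  then have "peval (wpart w (N - k) f) b = 0" using kN by simp
  then have "b = 0"
    using grad_zero wly by (auto simp: wly_at_infinity_def)
  then show False using b by (simp add: wsphere_def)
qed

text \<open>Points of norm above \<open>\<rho>\<close> have weighted radius \<open>R\<close> above
  \<open>Suc m\<close>, and \<open>w i \<le> N - k\<close> bounds \<open>norm x\<close> by a
  multiple of \<open>R ^ (N - k)\<close>, which \<open>legendre_growth_on_rays\<close>
  controls.\<close>

lemma wly_norm_le_legendre:
  fixes f :: "'n::finite cpoly"
  assumes wly: "wly_at_infinity w N k f" and large: "\<And>i. w i \<le> N - k"
  obtains \<epsilon> \<rho> C where "\<epsilon> > 0" "C > 0"
    "\<And>x. norm x > \<rho> \<Longrightarrow> norm (grad f x) \<le> \<epsilon> \<Longrightarrow> norm x \<le> C * norm (legendre f x)"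
proof -
  obtain m where m: "\<And>R y. R \<ge> real (Suc m) \<Longrightarrow> y \<in> wsphere \<Longrightarrow>
    norm (grad f (wscale w (complex_of_real R) y)) \<le> 1 / real (Suc m) \<Longrightarrow>
    R ^ (N - k) / real (Suc m) \<le> norm (legendre f (wscale w (complex_of_real R) y))"
    using legendre_growth_on_rays[OF assms] by blast
  have w_pos: "0 < w i" for i using wly by (simp add: wly_at_infinity_def weight_vector_def)
  define \<rho> where "\<rho> = real CARD('n) * real (Suc m) ^ (N - k)"
  have bound: "norm x \<le> (real CARD('n) * real (Suc m)) * norm (legendre f x)"
    if x: "norm x > \<rho>" "norm (grad f x) \<le> 1 / real (Suc m)" for x
  proof -
    have "\<rho> \<ge> 0" by (simp add: \<rho>_def)
    then have "x \<noteq> 0" using x(1) by auto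
    then obtain R y where Ry: "R > 0" "y \<in> wsphere" "x = wscale w (complex_of_real R) y"
      using wsphere_decomposition[of x w] w_pos by metis
    have R: "R > real (Suc m)"
    proof (rule ccontr)
      assume "\<not> ?thesis"
      then have "norm x \<le> \<rho>"
        unfolding \<rho>_def Ry(3) using Ry large by (intro norm_wscale_le) auto
      then show False using x(1) by simp
    qed
    have "norm x \<le> real CARD('n) * R ^ (N - k)"
      unfolding Ry(3) using Ry R large by (intro norm_wscale_le) auto
    also have "\<dots> = real CARD('n) * real (Suc m) * (R ^ (N - k) / real (Suc m))"
      by simp
    also have "\<dots> \<le> real CARD('n) * real (Suc m) * norm (legendre f x)"
      using m[of R y] R Ry x by (intro mult_left_mono) auto
    finally show ?thesis .
  qed
  show ?thesis
    by (rule that[OF _ _ bound]) auto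
qed

section \<open>Tameness\<close>

text \<open>The Legendre function is bounded on the ball of radius \<open>\<rho>\<close>, so its
  large values occur outside, where the growth estimate supplies the hypothesis of
  \<open>legendre_bounded\<close>. The resulting bound \<open>L\<close> and the growth estimate
  confine the points of small gradient outside that ball to norm at most
  \<open>C * L\<close>.\<close>

theorem wly_tame:
  fixes f :: "'n::finite cpoly"
  assumes wly: "wly_at_infinity w N k f" and large: "\<And>i. w i \<le> N - k"
  shows "tame f"
proof -
  obtain \<epsilon>0 \<rho> C where \<epsilon>0: "\<epsilon>0 > 0" and C: "C > 0"
    and growth: "\<And>x. norm x > \<rho> \<Longrightarrow> norm (grad f x) \<le> \<epsilon>0 \<Longrightarrow> norm x \<le> C * norm (legendre f x)"
    using wly_norm_le_legendre[OF assms] by metis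
  have "continuous_on UNIV (legendre f)"
    by (intro continuous_at_imp_continuous_on ballI has_derivative_continuous[OF has_derivative_legendre])
  then have "compact (legendre f ` cball 0 \<rho>)"
    by (intro compact_continuous_image) (auto intro: continuous_on_subset)
  then obtain B where B: "\<And>x. norm x \<le> \<rho> \<Longrightarrow> norm (legendre f x) \<le> B"
    by (force dest!: compact_imp_bounded simp: bounded_iff)
  have "norm x \<le> C * norm (legendre f x)" if "norm (grad f x) \<le> \<epsilon>0" "B + 1 \<le> norm (legendre f x)" for x
    using growth[of x] B[of x] that by force
  then obtain \<epsilon> L where \<epsilon>: "\<epsilon> > 0" and L: "\<And>x. norm (grad f x) \<le> \<epsilon> \<Longrightarrow> norm (legendre f x) \<le> L"
    using legendre_bounded[OF \<epsilon>0, of f "B + 1" C] by metis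
  show ?thesis
    unfolding tame_def
  proof (intro exI conjI allI impI)
    show "min \<epsilon>0 \<epsilon> > 0" using \<epsilon>0 \<epsilon> by simp
    show "compact (cball 0 (max \<rho> (C * L)) :: (complex ^ 'n) set)" by simp
    fix x :: "complex ^ 'n" assume "x \<notin> cball 0 (max \<rho> (C * L))"
    then have x: "norm x > \<rho>" "norm x > C * L" by auto
    show "norm (grad f x) > min \<epsilon>0 \<epsilon>"
    proof (rule ccontr)
      assume "\<not> ?thesis"
      then have "norm x \<le> C * norm (legendre f x)" "norm (legendre f x) \<le> L"
        using growth[OF x(1)] L[of x] by auto
      then show False using x(2) C mult_left_mono[of "norm (legendre f x)" L C] by linarith
    qed
  qed
qed

theorem corollary4p6:
  fixes f :: "'n::finite cpoly" and w :: "'n \<Rightarrow> nat" and N k :: nat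
  shows "(wly_at_infinity w N k f \<and>
          (k = 1 \<or>
           (\<exists>h :: 'n cpoly. of_type w N h \<and> isolated_sing_at_origin h) \<or>
           transversal_milnor_eq_tjurina w (wpart w N f)) \<and>
          N - k \<ge> Max (range w)
            \<longrightarrow> tame f)
       \<and> (wly_at_infinity (\<lambda>_. 1) N k f \<longrightarrow> tame f)"
proof (intro conjI impI)
  assume f: "wly_at_infinity w N k f \<and>
          (k = 1 \<or>
           (\<exists>h :: 'n cpoly. of_type w N h \<and> isolated_sing_at_origin h) \<or>
           transversal_milnor_eq_tjurina w (wpart w N f)) \<and>
          N - k \<ge> Max (range w)"
  then have "w i \<le> N - k" for i
    using Max_ge[of "range w" "w i"] by simp
  then show "tame f" using f wly_tame by blast
next
  assume f: "wly_at_infinity (\<lambda>_. 1) N k f"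
  \<comment> \<open>All weights are \<open>1\<close>, so \<open>k < N\<close> gives the weight
    bound.\<close>
  then have "1 \<le> N - k" by (auto simp: wly_at_infinity_def)
  then show "tame f" using f by (intro wly_tame[of "\<lambda>_. 1"]) auto
qed

end
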